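(* Let $p\ge1$, $\beta_0\in\mathbb R^p$, let $X$ be a random vector in $\mathbb R^p$ with Lebesgue density $f^X$ such that $\mathbb P(\|X\|\le B)=1$ for some $B>0$ and $\mathbb P(v^\top X=0)=0$ for every $v\in\mathbb R^p\setminus\{0\}$. Let $\epsilon$ be independent of $X$ with density $f(t)=c_\alpha\exp(-d^{-\alpha}|t|^\alpha)$, where $\alpha\ge1$, $d>0$, $c_\alpha=\frac{\alpha}{2d\Gamma(1/\alpha)}$, and $Y=\beta_0^\top X+\epsilon$, with density $f^Y(y)=\int f(y-\beta_0^\top x)f^X(x)\,dx$. Let $\tilde X_1,\dots,\tilde X_n$ be i.i.d. copies of $X$, $\tilde Y_1,\dots,\tilde Y_n$ i.i.d. copies of $Y$, and $(X_1,Y_1),\dots,(X_m,Y_m)$ i.i.d. copies of $(X,Y)$, the three samples mutually independent, and let $n,m\to\infty$ with $m/n\to\lambda\in(0,1)$. Define $$\ell_{n,m}(\beta)=\frac{1}{n+m}\sum_{j=1}^n\log\Big(\frac1n\sum_{i=1}^n f(\tilde Y_j-\beta^\top\tilde X_i)\Big)+\frac{1}{n+m}\sum_{k=1}^m\log f(Y_k-\beta^\top X_k),$$ $$\ell(\beta)=\frac{1}{1+\lambda}\int\log\Big(\int f(y-\beta^\top x)f^X(x)\,dx\Big)f^Y(y)\,dy+\frac{\lambda}{1+\lambda}\iint\log f(y-\beta^\top x)\,f(y-\beta_0^\top x)f^X(x)\,dx\,dy,$$ and $R^\ast=\max\Big(2\cdot 3^{1/\alpha}\big(\frac{1+\lambda}{\lambda}\cdot\frac{C}{b}\big)^{1/\alpha},\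 \|\beta_0\|\Big)$ with $b=\inf_{\|u\|=1}\mathbb E|u^\top X|^\alpha$ and $C=\mathbb E|Y|^\alpha$. Then $$\sup_{\|\beta\|\le R^\ast}|\ell_{n,m}(\beta)-\ell(\beta)|\to0\quad\text{in probability},$$ and for every $r>0$, $$\sup_{\beta\in\mathcal O_r}\ell(\beta)<\ell(\beta_0),\qquad \mathcal O_r=\{\beta:\|\beta\|<R^\ast\}\cap\{\beta:\|\beta-\beta_0\|>r\}.$$ In particular, $\widehat\beta_{n,m}\to\beta_0$ in probability as $n,m\to\infty$, where $\widehat\beta_{n,m}$ is any maximizer of $\ell_{n,m}$ over $\mathbb R^p$.
   Context: Linear regression with a matched sample of pairs and an unmatched sample of separately observed covariates and responses; probabilities refer to the joint law of all samples. $\|\cdot\|$ denotes the Euclidean norm. *)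

theory Defs
  imports "HOL-Probability.Probability"
begin

definition noise_dens :: "real \<Rightarrow> real \<Rightarrow> real \<Rightarrow> real" where
  "noise_dens \<alpha> d t = \<alpha> / (2 * d * Gamma (1 / \<alpha>)) * exp (- (d powr (- \<alpha>)) * \<bar>t\<bar> powr \<alpha>)"

definition dens_Y :: "real \<Rightarrow> real \<Rightarrow> real^'p \<Rightarrow> (real^'p \<Rightarrow> real) \<Rightarrow> real \<Rightarrow> real" where
  "dens_Y \<alpha> d \<beta>0 fX y = (LINT x|lborel. noise_dens \<alpha> d (y - \<beta>0 \<bullet> x) * fX x)"

definition ell_nm ::
  "real \<Rightarrow> real \<Rightarrow> (nat \<Rightarrow> real^'p) \<Rightarrow> (nat \<Rightarrow> real) \<Rightarrow> (nat \<Rightarrow> real^'p) \<Rightarrow> (nat \<Rightarrow> real)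
    \<Rightarrow> nat \<Rightarrow> nat \<Rightarrow> real^'p \<Rightarrow> real" where
  "ell_nm \<alpha> d Xt Yt Xs Ys n m \<beta> =
     1 / real (n + m) * (\<Sum>j<n. ln (1 / real n * (\<Sum>i<n. noise_dens \<alpha> d (Yt j - \<beta> \<bullet> Xt i))))
   + 1 / real (n + m) * (\<Sum>k<m. ln (noise_dens \<alpha> d (Ys k - \<beta> \<bullet> Xs k)))"

definition ell_pop :: "real \<Rightarrow> real \<Rightarrow> real \<Rightarrow> real^'p \<Rightarrow> (real^'p \<Rightarrow> real) \<Rightarrow> real^'p \<Rightarrow> real" where
  "ell_pop \<alpha> d lam \<beta>0 fX \<beta> =
     1 / (1 + lam) * (LINT y|lborel. ln (LINT x|lborel. noise_dens \<alpha> d (y - \<beta> \<bullet> x) * fX x)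
                                     * dens_Y \<alpha> d \<beta>0 fX y)
   + lam / (1 + lam) * (LINT y|lborel. LINT x|lborel.
          ln (noise_dens \<alpha> d (y - \<beta> \<bullet> x)) * noise_dens \<alpha> d (y - \<beta>0 \<bullet> x) * fX x)"

text \<open>Convergence in (outer) probability to 0 of nonnegative quantities Z k.\<close>
definition conv_prob_zero :: "'a measure \<Rightarrow> (nat \<Rightarrow> 'a \<Rightarrow> ereal) \<Rightarrow> bool" where
  "conv_prob_zero M Z \<longleftrightarrow> (\<forall>e>0. \<forall>\<delta>>0. eventually (\<lambda>k. \<exists>A\<in>sets M.
      {\<omega>\<in>space M. Z k \<omega> > ereal e} \<subseteq> A \<and> measure M A < \<delta>) sequentially)"

end

theory Submission
  imports Defs
begin

text \<open>
  For a fixed \<open>\<beta>\<close> the criterion converges in \<open>L\<^sup>1\<close>: the matched part is an i.i.d. average, and in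
  the unmatched part the empirical mixture at a point \<open>y\<close> is within \<open>O(N powr (-1/2))\<close> of the true one,
  so that integrating over the independent \<open>y\<close> with an integrable envelope leaves again an i.i.d.
  average. On a ball the logarithm of the noise density is Lipschitz in \<open>\<beta>\<close> with a constant
  integrable in \<open>y\<close>; taking the logarithm of an average preserves this constant, so a finite net
  turns pointwise into uniform convergence. Both parts of the limit decrease away from \<open>\<beta>0\<close> by
  Gibbs' inequality, the matched part strictly. Finally, a maximizer beats \<open>\<beta> = 0\<close>, which bounds
  the average of \<open>|\<beta> \<bullet> X|^\<alpha>\<close> by the responses and thereby confines it to the ball of radius \<open>Rstar\<close>.
\<close>

section \<open>Convergence in outer probability\<close>

text \<open>Three obstacles shape the proof. The terms of the unmatched sum share all covariates
  \<open>Xt\<close>, so this sum is not an i.i.d. average; what is available is the independence of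
  the whole sequence \<open>Xt\<close> from a single \<open>Yt j\<close>, and it enters through
  Tonelli. The lower bound for the mixture at \<open>y\<close> decays exponentially in a power of
  \<open>\<bar>y\<bar>\<close>, so the rate of the empirical mixture degrades with \<open>y\<close>
  and has to be capped before integrating. Suprema over a ball and arbitrary maximizers may fail to
  be measurable, hence outer probability throughout.

  The unmatched part alone does not identify \<open>\<beta>0\<close>: for symmetric \<open>X\<close>
  the parameters \<open>\<beta>\<close> and \<open>- \<beta>\<close> give the same mixture.
  Strictness must come from the matched pairs, whose weight stays positive since
  \<open>lam > 0\<close>.

  In \<open>Rstar\<close> the leading 2 stems from a power inequality for sums, the 3 leaves room
  for sampling error above the value 2 that the comparison with \<open>\<beta> = 0\<close> yields in
  the limit, and \<open>(1 + lam) / lam\<close> inverts the limiting weight of the matched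
  pairs.\<close>

definition whp :: "'a measure \<Rightarrow> (nat \<Rightarrow> 'a \<Rightarrow> bool) \<Rightarrow> bool" where
  "whp M P \<longleftrightarrow> (\<forall>\<delta>>0. eventually (\<lambda>k. \<exists>A\<in>sets M.
      {\<omega>\<in>space M. \<not> P k \<omega>} \<subseteq> A \<and> measure M A < \<delta>) sequentially)"

lemma conv_prob_zero_iff_whp:
  "conv_prob_zero M Z \<longleftrightarrow> (\<forall>e>0. whp M (\<lambda>k \<omega>. Z k \<omega> \<le> ereal e))"
  unfolding conv_prob_zero_def whp_def not_le by simp

text \<open>The implication is required for large \<open>k\<close> only, so that facts such as
  \<open>n k > 0\<close> can enter it.\<close>

lemma whp_mono:
  assumes "whp M P" "eventually (\<lambda>k. \<forall>\<omega>\<in>space M. P k \<omega> \<longrightarrow> Q k \<omega>) sequentially"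
  shows "whp M Q"
  unfolding whp_def
proof (intro allI impI)
  fix \<delta> :: real assume "\<delta> > 0"
  with assms(1) have "\<forall>\<^sub>F k in sequentially.
      \<exists>A\<in>sets M. {\<omega>\<in>space M. \<not> P k \<omega>} \<subseteq> A \<and> measure M A < \<delta>"
    unfolding whp_def by blast
  with assms(2) show "\<forall>\<^sub>F k in sequentially.
      \<exists>A\<in>sets M. {\<omega>\<in>space M. \<not> Q k \<omega>} \<subseteq> A \<and> measure M A < \<delta>"
    by eventually_elim blast
qed

context prob_space
begin

lemma whp_conj:
  assumes "whp M P" "whp M Q"
  shows "whp M (\<lambda>k \<omega>. P k \<omega> \<and> Q k \<omega>)"
  unfolding whp_def
proof (intro allI impI)
  fix \<delta> :: real assume "\<delta> > 0"
  then have "\<forall>\<^sub>F k in sequentially.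
      \<exists>A\<in>sets M. {\<omega>\<in>space M. \<not> P k \<omega>} \<subseteq> A \<and> measure M A < \<delta> / 2"
    "\<forall>\<^sub>F k in sequentially.
      \<exists>A\<in>sets M. {\<omega>\<in>space M. \<not> Q k \<omega>} \<subseteq> A \<and> measure M A < \<delta> / 2"
    using assms unfolding whp_def by (auto dest: spec[of _ "\<delta> / 2"])
  then show "\<forall>\<^sub>F k in sequentially.
      \<exists>A\<in>sets M. {\<omega>\<in>space M. \<not> (P k \<omega> \<and> Q k \<omega>)} \<subseteq> A \<and> measure M A < \<delta>"
  proof eventually_elim
    case (elim k)
    then obtain A A' where *: "A \<in> sets M" "{\<omega>\<in>space M. \<not> P k \<omega>} \<subseteq> A" "measure M A < \<delta> / 2"
      "A' \<in> sets M" "{\<omega>\<in>space M. \<not> Q k \<omega>} \<subseteq> A'" "measure M A' < \<delta> / 2" by blast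
    have "measure M (A \<union> A') \<le> measure M A + measure M A'"
      using * by (intro measure_subadditive) auto
    with * show ?case by (intro bexI[of _ "A \<union> A'"]) auto
  qed
qed

lemma whp_AE:
  assumes "AE \<omega> in M. P \<omega>"
  shows "whp M (\<lambda>_. P)"
proof -
  from AE_E[OF assms] obtain N where "{\<omega>\<in>space M. \<not> P \<omega>} \<subseteq> N" "emeasure M N = 0" "N \<in> sets M"
    by blast
  then show ?thesis
    unfolding whp_def by (intro allI impI always_eventually bexI[of _ N]) (auto simp: measure_def)
qed

lemma whp_finite_ball:
  assumes "finite F" "\<And>\<theta>. \<theta> \<in> F \<Longrightarrow> whp M (P \<theta>)"
  shows "whp M (\<lambda>k \<omega>. \<forall>\<theta>\<in>F. P \<theta> k \<omega>)"
  using assms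
proof (induction F)
  case empty
  show ?case using whp_AE[of "\<lambda>_. True"] by simp
next
  case (insert \<theta> F)
  then have "whp M (\<lambda>k \<omega>. P \<theta> k \<omega> \<and> (\<forall>\<theta>\<in>F. P \<theta> k \<omega>))" by (intro whp_conj) auto
  then show ?case by simp
qed

section \<open>Convergence in mean and the weak law\<close>

lemma whp_of_L1:
  fixes Z :: "nat \<Rightarrow> 'a \<Rightarrow> real"
  assumes [simp]: "\<And>k. integrable M (Z k)"
    and lim: "(\<lambda>k. expectation (\<lambda>\<omega>. \<bar>Z k \<omega> - z\<bar>)) \<longlonglongrightarrow> 0"
    and "e > 0"
  shows "whp M (\<lambda>k \<omega>. \<bar>Z k \<omega> - z\<bar> < e)"
  unfolding whp_def
proof (intro allI impI)
  fix \<delta> :: real assume "\<delta> > 0"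
  with \<open>e > 0\<close> have "\<forall>\<^sub>F k in sequentially. expectation (\<lambda>\<omega>. \<bar>Z k \<omega> - z\<bar>) < \<delta> * e"
    by (intro order_tendstoD(2)[OF lim]) auto
  then show "\<forall>\<^sub>F k in sequentially.
      \<exists>A\<in>sets M. {\<omega>\<in>space M. \<not> \<bar>Z k \<omega> - z\<bar> < e} \<subseteq> A \<and> measure M A < \<delta>"
  proof eventually_elim
    case (elim k)
    have [measurable]: "Z k \<in> borel_measurable M" by (simp add: borel_measurable_integrable)
    have "measure M {\<omega>\<in>space M. \<bar>Z k \<omega> - z\<bar> \<ge> e} \<le> expectation (\<lambda>\<omega>. \<bar>Z k \<omega> - z\<bar>) / e"
      using \<open>e > 0\<close> by (intro integral_Markov_inequality_measure[where A="{}"]) auto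
    also have "\<dots> < \<delta>" using elim \<open>e > 0\<close> by (simp add: field_simps)
    finally show ?case
      by (intro bexI[of _ "{\<omega>\<in>space M. \<bar>Z k \<omega> - z\<bar> \<ge> e}"]) auto
  qed
qed

text \<open>The moment bound is the nonnegativity of the variance of
  \<open>\<bar>Z\<bar>\<close>.\<close>

lemma L1_le_sqrt_L2:
  fixes Z :: "'a \<Rightarrow> real"
  assumes [measurable]: "Z \<in> borel_measurable M" and "integrable M (\<lambda>\<omega>. (Z \<omega>)\<^sup>2)"
  shows "integrable M Z" "expectation (\<lambda>\<omega>. \<bar>Z \<omega>\<bar>) \<le> sqrt (expectation (\<lambda>\<omega>. (Z \<omega>)\<^sup>2))"
proof -
  show i: "integrable M Z"
  proof (rule Bochner_Integration.integrable_bound)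
    show "integrable M (\<lambda>\<omega>. (Z \<omega>)\<^sup>2 + 1)" using assms by simp
    show "AE \<omega> in M. norm (Z \<omega>) \<le> norm ((Z \<omega>)\<^sup>2 + 1)"
    proof (intro AE_I2)
      fix \<omega>
      \<comment> \<open>Expanding the square gives
        \<open>\<bar>z\<bar> \<le> z\<^sup>2 + 1/4\<close>.\<close>
      have "0 \<le> (\<bar>Z \<omega>\<bar> - 1/2)\<^sup>2" by simp
      then show "norm (Z \<omega>) \<le> norm ((Z \<omega>)\<^sup>2 + 1)" by (simp add: power2_eq_square algebra_simps)
    qed
  qed simp
  have "0 \<le> variance (\<lambda>\<omega>. \<bar>Z \<omega>\<bar>)" by (rule variance_positive)
  also have "\<dots> = expectation (\<lambda>\<omega>. (Z \<omega>)\<^sup>2) - (expectation (\<lambda>\<omega>. \<bar>Z \<omega>\<bar>))\<^sup>2"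
    using i assms by (subst variance_eq) auto
  finally show "expectation (\<lambda>\<omega>. \<bar>Z \<omega>\<bar>) \<le> sqrt (expectation (\<lambda>\<omega>. (Z \<omega>)\<^sup>2))"
    by (intro real_le_rsqrt) auto
qed

text \<open>The cross terms of the squared centered average vanish by independence, and only the
  diagonal is left. The injection \<open>s\<close> selects one sample from a jointly independent
  family and \<open>\<phi>\<close> reads off what is averaged. The rate is explicit, so that it can
  later be integrated over a further variable.\<close>

lemma weak_law_L1:
  fixes W :: "'s \<Rightarrow> 'a \<Rightarrow> 'c::topological_space" and s :: "nat \<Rightarrow> 's" and \<phi> :: "'c \<Rightarrow> real"
  assumes indep: "indep_vars (\<lambda>_. borel) W UNIV" and s: "inj s"
    and \<phi>[measurable]: "\<phi> \<in> borel_measurable borel"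
    and int2: "\<And>i. integrable M (\<lambda>\<omega>. (\<phi> (W (s i) \<omega>))\<^sup>2)"
    and mean: "\<And>i. expectation (\<lambda>\<omega>. \<phi> (W (s i) \<omega>)) = \<mu>"
    and bound: "\<And>i. expectation (\<lambda>\<omega>. (\<phi> (W (s i) \<omega>))\<^sup>2) \<le> v"
    and N: "N > 0"
  shows "expectation (\<lambda>\<omega>. \<bar>(\<Sum>i<N. \<phi> (W (s i) \<omega>)) / real N - \<mu>\<bar>) \<le> sqrt (v / real N)"
proof -
  define \<xi> where "\<xi> i \<omega> = \<phi> (W (s i) \<omega>) - \<mu>" for i \<omega>
  have W[measurable]: "W t \<in> borel_measurable M" for t
    using indep unfolding indep_vars_def by auto
  have [measurable]: "\<xi> i \<in> borel_measurable M" for i unfolding \<xi>_def by measurable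
  have i1: "integrable M (\<lambda>\<omega>. \<phi> (W (s i) \<omega>))" for i
    by (rule L1_le_sqrt_L2(1)) (use int2 in auto)
  then have i\<xi>: "integrable M (\<xi> i)" for i unfolding \<xi>_def by auto
  have E\<xi>: "expectation (\<xi> i) = 0" for i
    unfolding \<xi>_def using i1 mean by (simp add: prob_space)
  have i\<xi>2: "integrable M (\<lambda>\<omega>. (\<xi> i \<omega>)\<^sup>2)" for i
    unfolding \<xi>_def power2_diff using i1 int2 by auto
  have E\<xi>2: "expectation (\<lambda>\<omega>. (\<xi> i \<omega>)\<^sup>2) \<le> v" for i
  proof -
    have "expectation (\<lambda>\<omega>. (\<xi> i \<omega>)\<^sup>2) = expectation (\<lambda>\<omega>. (\<phi> (W (s i) \<omega>))\<^sup>2) - \<mu>\<^sup>2"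
      using variance_eq[OF i1 int2, of i] by (simp add: mean \<xi>_def)
    with bound[of i] show ?thesis by (simp add: order_trans[of _ "expectation (\<lambda>\<omega>. (\<phi> (W (s i) \<omega>))\<^sup>2)"])
  qed
  have off: "integrable M (\<lambda>\<omega>. \<xi> i \<omega> * \<xi> j \<omega>) \<and> expectation (\<lambda>\<omega>. \<xi> i \<omega> * \<xi> j \<omega>) = 0"
    if "i \<noteq> j" for i j
  proof -
    \<comment> \<open>Same variables as \<open>\<xi>\<close>, but indexed by the family's own index
      set, on which independence is given; injectivity of \<open>s\<close> makes
      \<open>{s i, s j}\<close> a genuine pair.\<close>
    define \<psi> where "\<psi> t \<omega> = \<phi> (W t \<omega>) - \<mu>" for t \<omega>
    have "s i \<noteq> s j" using s that by (auto dest: injD)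
    have ind: "indep_vars (\<lambda>_. borel) \<psi> {s i, s j}"
      unfolding \<psi>_def
      by (rule indep_vars_compose2[OF indep_vars_subset[OF indep]]) auto
    have int: "integrable M (\<psi> t)" if "t \<in> {s i, s j}" for t
      using that i\<xi> unfolding \<xi>_def \<psi>_def by auto
    have prod: "(\<Prod>t\<in>{s i, s j}. \<psi> t \<omega>) = \<xi> i \<omega> * \<xi> j \<omega>" for \<omega>
      using \<open>s i \<noteq> s j\<close> by (simp add: \<psi>_def \<xi>_def)
    have "(\<Prod>t\<in>{s i, s j}. expectation (\<psi> t)) = 0"
      using \<open>s i \<noteq> s j\<close> E\<xi>[of i] by (simp add: \<psi>_def[abs_def] \<xi>_def[abs_def])
    with indep_vars_lebesgue_integral[OF _ ind int] indep_vars_integrable[OF _ ind int]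
    show ?thesis unfolding prod by simp
  qed
  have ip: "integrable M (\<lambda>\<omega>. \<xi> i \<omega> * \<xi> j \<omega>)" for i j
    using off[of i j] i\<xi>2[of i] by (cases "i = j") (auto simp: power2_eq_square)
  define S where "S \<omega> = (\<Sum>i<N. \<xi> i \<omega>) / real N" for \<omega>
  have [measurable]: "S \<in> borel_measurable M" unfolding S_def by measurable
  have S2: "(S \<omega>)\<^sup>2 = (\<Sum>i<N. \<Sum>j<N. \<xi> i \<omega> * \<xi> j \<omega>) / (real N)\<^sup>2" for \<omega>
    unfolding S_def power_divide by (simp add: power2_eq_square sum_product)
  have iS2: "integrable M (\<lambda>\<omega>. (S \<omega>)\<^sup>2)" unfolding S2 using ip by auto
  have "expectation (\<lambda>\<omega>. (S \<omega>)\<^sup>2) = (\<Sum>i<N. \<Sum>j<N. expectation (\<lambda>\<omega>. \<xi> i \<omega> * \<xi> j \<omega>)) / (real N)\<^sup>2"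
    unfolding S2 using ip by simp
  also have "(\<Sum>i<N. \<Sum>j<N. expectation (\<lambda>\<omega>. \<xi> i \<omega> * \<xi> j \<omega>))
      = (\<Sum>i<N. \<Sum>j<N. if j = i then expectation (\<lambda>\<omega>. (\<xi> i \<omega>)\<^sup>2) else 0)"
    using off by (intro sum.cong) (auto simp: power2_eq_square)
  also have "\<dots> = (\<Sum>i<N. expectation (\<lambda>\<omega>. (\<xi> i \<omega>)\<^sup>2))" by simp
  also have "(\<dots>) / (real N)\<^sup>2 \<le> (\<Sum>i<N. v) / (real N)\<^sup>2"
    by (intro divide_right_mono sum_mono E\<xi>2) auto
  also have "\<dots> = v / real N" using N by (simp add: power2_eq_square)
  finally have ES2: "expectation (\<lambda>\<omega>. (S \<omega>)\<^sup>2) \<le> v / real N" .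
  have "(\<Sum>i<N. \<phi> (W (s i) \<omega>)) / real N - \<mu> = S \<omega>" for \<omega>
    unfolding S_def \<xi>_def using N by (simp add: sum_subtractf field_simps)
  then have "expectation (\<lambda>\<omega>. \<bar>(\<Sum>i<N. \<phi> (W (s i) \<omega>)) / real N - \<mu>\<bar>)
      = expectation (\<lambda>\<omega>. \<bar>S \<omega>\<bar>)" by simp
  also have "\<dots> \<le> sqrt (expectation (\<lambda>\<omega>. (S \<omega>)\<^sup>2))"
    by (rule L1_le_sqrt_L2(2)) (use iS2 in auto)
  also have "\<dots> \<le> sqrt (v / real N)" using ES2 by simp
  finally show ?thesis .
qed

section \<open>From pointwise to uniform convergence on a compact set\<close>

context
  fixes K :: "'b::metric_space set" and Z :: "nat \<Rightarrow> 'b \<Rightarrow> 'a \<Rightarrow> real" and z :: "'b \<Rightarrow> real"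
    and D :: "nat \<Rightarrow> 'a \<Rightarrow> real" and Dbar :: real
  assumes int: "\<And>k \<theta>. \<theta> \<in> K \<Longrightarrow> integrable M (Z k \<theta>)"
    and pt: "\<And>\<theta>. \<theta> \<in> K \<Longrightarrow> (\<lambda>k. expectation (\<lambda>\<omega>. \<bar>Z k \<theta> \<omega> - z \<theta>\<bar>)) \<longlonglongrightarrow> 0"
    and lip: "AE \<omega> in M. \<forall>k. \<forall>\<theta>\<in>K. \<forall>\<theta>'\<in>K. \<bar>Z k \<theta> \<omega> - Z k \<theta>' \<omega>\<bar> \<le> D k \<omega> * dist \<theta> \<theta>'"
    and D: "\<And>k. integrable M (D k)" "\<And>k \<omega>. D k \<omega> \<ge> 0" "\<And>k. expectation (D k) \<le> Dbar"
begin

text \<open>The limit inherits its modulus from the random functions: insert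
  \<open>Z k \<theta>\<close> and \<open>Z k \<theta>'\<close>, take expectations, and let
  \<open>k\<close> grow. The limit itself never has to be examined.\<close>

lemma L1_limit_lipschitz:
  assumes "\<theta> \<in> K" "\<theta>' \<in> K"
  shows "\<bar>z \<theta> - z \<theta>'\<bar> \<le> Dbar * dist \<theta> \<theta>'"
proof (rule tendsto_lowerbound)
  let ?r = "\<lambda>k. expectation (\<lambda>\<omega>. \<bar>Z k \<theta> \<omega> - z \<theta>\<bar>) + expectation (\<lambda>\<omega>. \<bar>Z k \<theta>' \<omega> - z \<theta>'\<bar>)
     + Dbar * dist \<theta> \<theta>'"
  have "?r \<longlonglongrightarrow> 0 + 0 + Dbar * dist \<theta> \<theta>'"
    by (intro tendsto_intros pt assms)
  then show "?r \<longlonglongrightarrow> Dbar * dist \<theta> \<theta>'" by simp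
  have "\<bar>z \<theta> - z \<theta>'\<bar> \<le> ?r k" for k
  proof -
    have "\<bar>z \<theta> - z \<theta>'\<bar> = expectation (\<lambda>\<omega>. \<bar>z \<theta> - z \<theta>'\<bar>)" by (simp add: prob_space)
    also have "\<dots> \<le> expectation (\<lambda>\<omega>. \<bar>Z k \<theta> \<omega> - z \<theta>\<bar> + \<bar>Z k \<theta>' \<omega> - z \<theta>'\<bar> + D k \<omega> * dist \<theta> \<theta>')"
    proof (rule integral_mono_AE)
      show "AE \<omega> in M. \<bar>z \<theta> - z \<theta>'\<bar> \<le> \<bar>Z k \<theta> \<omega> - z \<theta>\<bar> + \<bar>Z k \<theta>' \<omega> - z \<theta>'\<bar> + D k \<omega> * dist \<theta> \<theta>'"
        using lip
      proof eventually_elim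
        case (elim \<omega>)
        with assms have "\<bar>Z k \<theta> \<omega> - Z k \<theta>' \<omega>\<bar> \<le> D k \<omega> * dist \<theta> \<theta>'" by blast
        then show ?case by linarith
      qed
    qed (use int[OF assms(1)] int[OF assms(2)] D(1) in auto)
    also have "\<dots> = expectation (\<lambda>\<omega>. \<bar>Z k \<theta> \<omega> - z \<theta>\<bar>) + expectation (\<lambda>\<omega>. \<bar>Z k \<theta>' \<omega> - z \<theta>'\<bar>)
        + expectation (D k) * dist \<theta> \<theta>'"
      using int[OF assms(1)] int[OF assms(2)] D(1) by simp
    also have "\<dots> \<le> ?r k" using D(3) by (intro add_mono mult_right_mono) auto
    finally show ?thesis .
  qed
  then show "\<forall>\<^sub>F k in sequentially. \<bar>z \<theta> - z \<theta>'\<bar> \<le> ?r k" by simp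
qed simp

lemma whp_uniform:
  assumes K: "compact K" and e: "e > 0"
  shows "whp M (\<lambda>k \<omega>. \<forall>\<theta>\<in>K. \<bar>Z k \<theta> \<omega> - z \<theta>\<bar> \<le> e)"
  unfolding whp_def
proof (intro allI impI)
  fix \<delta> :: real assume \<delta>: "\<delta> > 0"
  have Dbar: "Dbar \<ge> 0" using D(3)[of 0] Bochner_Integration.integral_nonneg[of M "D 0", OF D(2)] by linarith
  \<comment> \<open>Markov threshold: \<open>D k\<close> exceeds \<open>T\<close> with probability
    at most \<open>Dbar / T \<le> \<delta> / 2\<close>. The summand 1 keeps \<open>T\<close>
    positive when \<open>Dbar = 0\<close>.\<close>
  define T where "T = 2 * (Dbar + 1) / \<delta>"
  have T: "T > 0" using Dbar \<delta> by (simp add: T_def)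
  \<comment> \<open>Mesh of the net: moving to a net point costs at most \<open>T * \<rho>\<close>
    in \<open>Z k\<close> and \<open>Dbar * \<rho>\<close> in \<open>z\<close>, together
    \<open>e / 2\<close>; the other half is the error at the net point. The mesh depends on
    \<open>\<delta>\<close> through \<open>T\<close>.\<close>
  define \<rho> where "\<rho> = e / (2 * (T + Dbar))"
  have \<rho>: "\<rho> > 0" using T Dbar e by (simp add: \<rho>_def)
  from \<rho> obtain F where F: "finite F" "F \<subseteq> K" "K \<subseteq> (\<Union>x\<in>F. ball x \<rho>)"
    using compactE_image[OF K, of K "\<lambda>x. ball x \<rho>"] by (metis (no_types, lifting) UN_iff centre_in_ball open_ball subsetI)
  have "whp M (\<lambda>k \<omega>. (\<forall>\<theta>\<in>F. \<bar>Z k \<theta> \<omega> - z \<theta>\<bar> < e / 2) \<and>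
      (\<forall>k. \<forall>\<theta>\<in>K. \<forall>\<theta>'\<in>K. \<bar>Z k \<theta> \<omega> - Z k \<theta>' \<omega>\<bar> \<le> D k \<omega> * dist \<theta> \<theta>'))"
    using F e by (intro whp_conj whp_AE lip whp_finite_ball whp_of_L1 int pt) auto
  then have "\<forall>\<^sub>F k in sequentially. \<exists>A\<in>sets M. {\<omega>\<in>space M. \<not> ((\<forall>\<theta>\<in>F. \<bar>Z k \<theta> \<omega> - z \<theta>\<bar> < e / 2) \<and>
      (\<forall>k. \<forall>\<theta>\<in>K. \<forall>\<theta>'\<in>K. \<bar>Z k \<theta> \<omega> - Z k \<theta>' \<omega>\<bar> \<le> D k \<omega> * dist \<theta> \<theta>'))} \<subseteq> A \<and> measure M A < \<delta> / 2"
    using \<delta> unfolding whp_def by (auto dest!: spec[of _ "\<delta> / 2"])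
  then show "\<forall>\<^sub>F k in sequentially.
      \<exists>A\<in>sets M. {\<omega>\<in>space M. \<not> (\<forall>\<theta>\<in>K. \<bar>Z k \<theta> \<omega> - z \<theta>\<bar> \<le> e)} \<subseteq> A \<and> measure M A < \<delta>"
  proof eventually_elim
    case (elim k)
    then obtain A where A: "A \<in> sets M" "measure M A < \<delta> / 2"
      and sub: "\<And>\<omega>. \<omega> \<in> space M - A \<Longrightarrow> (\<forall>\<theta>\<in>F. \<bar>Z k \<theta> \<omega> - z \<theta>\<bar> < e / 2) \<and>
      (\<forall>\<theta>\<in>K. \<forall>\<theta>'\<in>K. \<bar>Z k \<theta> \<omega> - Z k \<theta>' \<omega>\<bar> \<le> D k \<omega> * dist \<theta> \<theta>')" by blast
    have [measurable]: "D k \<in> borel_measurable M" using D(1) by (simp add: borel_measurable_integrable)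
    define A' where "A' = {\<omega>\<in>space M. D k \<omega> \<ge> T}"
    have [measurable]: "A' \<in> sets M" unfolding A'_def by measurable
    have "measure M A' \<le> expectation (D k) / T"
      unfolding A'_def using D T by (intro integral_Markov_inequality_measure[where A="{}"]) auto
    also have "\<dots> \<le> Dbar / T" using D(3) T by (intro divide_right_mono) auto
    also have "\<dots> \<le> \<delta> / 2" using Dbar \<delta> by (simp add: T_def field_simps)
    finally have "measure M (A \<union> A') < \<delta>"
      using measure_subadditive[of A M A'] A by simp
    moreover have "\<bar>Z k \<theta> \<omega> - z \<theta>\<bar> \<le> e" if "\<omega> \<in> space M" "\<omega> \<notin> A \<union> A'" "\<theta> \<in> K" for \<omega> \<theta>
    proof -
      obtain \<theta>' where \<theta>': "\<theta>' \<in> F" "dist \<theta>' \<theta> < \<rho>"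
        using F(3) \<open>\<theta> \<in> K\<close> by auto
      have "\<theta>' \<in> K" using F \<theta>' by auto
      have "\<bar>Z k \<theta> \<omega> - Z k \<theta>' \<omega>\<bar> \<le> D k \<omega> * dist \<theta> \<theta>'" using sub that \<open>\<theta>' \<in> K\<close> by blast
      also have "\<dots> \<le> T * \<rho>" using that \<theta>' T by (intro mult_mono) (auto simp: A'_def dist_commute)
      finally have 1: "\<bar>Z k \<theta> \<omega> - Z k \<theta>' \<omega>\<bar> \<le> T * \<rho>" .
      have "\<bar>z \<theta> - z \<theta>'\<bar> \<le> Dbar * dist \<theta> \<theta>'" by (rule L1_limit_lipschitz) fact+
      also have "\<dots> \<le> Dbar * \<rho>" using Dbar \<theta>' by (intro mult_left_mono) (auto simp: dist_commute)
      finally have 2: "\<bar>z \<theta> - z \<theta>'\<bar> \<le> Dbar * \<rho>" .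
      have 3: "\<bar>Z k \<theta>' \<omega> - z \<theta>'\<bar> < e / 2" using sub that \<theta>' by blast
      have "T + Dbar \<noteq> 0" using T Dbar by simp
      then have "(T + Dbar) * \<rho> = e / 2" by (simp add: \<rho>_def divide_simps)
      then have "T * \<rho> + Dbar * \<rho> = e / 2" by (simp add: distrib_right)
      with 1 2 3 show ?thesis by linarith
    qed
    ultimately show ?case using A(1) by (intro bexI[of _ "A \<union> A'"]) auto
  qed
qed

end

end

section \<open>The noise density\<close>

text \<open>Mean value theorem on the half-line, where the derivative is at most
  \<open>\<alpha> * T powr (\<alpha> - 1)\<close>. The exponent is raised to
  \<open>\<alpha>\<close>, which \<open>T \<ge> 1\<close> permits, so that one and the same power
  bounds both the size and the slope of the log density.\<close>

lemma abs_powr_diff_le: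
  fixes s t T \<alpha> :: real
  assumes "\<alpha> \<ge> 1" "\<bar>s\<bar> \<le> T" "\<bar>t\<bar> \<le> T" "T \<ge> 1"
  shows "\<bar>\<bar>s\<bar> powr \<alpha> - \<bar>t\<bar> powr \<alpha>\<bar> \<le> \<alpha> * T powr \<alpha> * \<bar>s - t\<bar>"
proof -
  have main: "b powr \<alpha> - a powr \<alpha> \<le> \<alpha> * T powr \<alpha> * (b - a)" if "0 \<le> a" "a \<le> b" "b \<le> T" for a b
  proof -
    have ab: "0 \<le> a" "a \<le> b" "b \<le> T" by fact+
    have diff: "(\<lambda>x. x powr \<alpha>) differentiable (at x)" if "x > 0" for x :: real
      unfolding real_differentiable_def using has_real_derivative_powr[OF that] by blast
    have cont: "continuous_on {a..b} (\<lambda>x. x powr \<alpha>)"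
      using assms that by (intro continuous_on_powr' continuous_intros) auto
    show ?thesis
    proof (cases "a = b")
      case False
      with that have "a < b" by simp
      obtain z where z: "z > a" "z < b" "b powr \<alpha> - a powr \<alpha> = (b - a) * (\<alpha> * z powr (\<alpha> - 1))"
      proof -
        have "\<exists>l z. a < z \<and> z < b \<and> DERIV (\<lambda>x. x powr \<alpha>) z :> l
            \<and> b powr \<alpha> - a powr \<alpha> = (b - a) * l"
          using \<open>a < b\<close> cont by (intro MVT diff) (use ab in auto)
        then obtain l z where z: "a < z" "z < b" "DERIV (\<lambda>x. x powr \<alpha>) z :> l"
          "b powr \<alpha> - a powr \<alpha> = (b - a) * l" by blast
        moreover have "l = \<alpha> * z powr (\<alpha> - 1)"
          using has_real_derivative_powr[of z \<alpha>] z ab by (intro DERIV_unique[OF z(3)]) auto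
        ultimately show ?thesis using that by blast
      qed
      have "z powr (\<alpha> - 1) \<le> T powr (\<alpha> - 1)" using z that assms by (intro powr_mono2) auto
      also have "\<dots> \<le> T powr \<alpha>" using assms by (intro powr_mono) auto
      finally have "(b - a) * (\<alpha> * z powr (\<alpha> - 1)) \<le> (b - a) * (\<alpha> * T powr \<alpha>)"
        using z assms by (intro mult_left_mono) auto
      with z show ?thesis by (simp add: mult_ac)
    qed simp
  qed
  have *: "\<bar>\<bar>s\<bar> powr \<alpha> - \<bar>t\<bar> powr \<alpha>\<bar> \<le> \<alpha> * T powr \<alpha> * (\<bar>\<bar>s\<bar> - \<bar>t\<bar>\<bar>)"
    using main[of "\<bar>s\<bar>" "\<bar>t\<bar>"] main[of "\<bar>t\<bar>" "\<bar>s\<bar>"] assms powr_mono2[of \<alpha> "\<bar>s\<bar>" "\<bar>t\<bar>"]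
      powr_mono2[of \<alpha> "\<bar>t\<bar>" "\<bar>s\<bar>"]
    by (cases "\<bar>s\<bar> \<le> \<bar>t\<bar>") auto
  also have "\<dots> \<le> \<alpha> * T powr \<alpha> * \<bar>s - t\<bar>"
    using assms by (intro mult_left_mono abs_triangle_ineq3) auto
  finally show ?thesis .
qed

text \<open>This is \<open>ln x \<le> x - 1\<close> at \<open>x = u * a / q\<close>, multiplied by
  \<open>q\<close> and exponentiated.\<close>

lemma powr_le_exp:
  fixes u q a :: real
  assumes "u > 0" "q > 0" "a > 0"
  shows "u powr q \<le> (q / a) powr q * exp (a * u)"
proof -
  have "ln (u * a / q) \<le> u * a / q - 1" using assms by (intro ln_le_minus_one) auto
  then have "ln u \<le> u * a / q + ln (q / a)"
    using assms by (simp add: ln_mult ln_div)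
  then have "q * ln u \<le> q * (u * a / q + ln (q / a))" using assms by (intro mult_left_mono) auto
  also have "\<dots> = a * u + q * ln (q / a)" using assms by (simp add: field_simps)
  finally have "exp (q * ln u) \<le> exp (a * u + q * ln (q / a))" by simp
  then show ?thesis using assms by (simp add: powr_def exp_add mult_ac)
qed

text \<open>Termwise comparison up to the factor \<open>exp D\<close> survives summation. Hence the
  log of a mixture is as Lipschitz in the parameter as the log of a single component.\<close>

lemma ln_avg_diff_le:
  fixes a b :: "nat \<Rightarrow> real"
  assumes "N > 0" "\<And>i. i < N \<Longrightarrow> a i > 0" "\<And>i. i < N \<Longrightarrow> b i > 0"
    "\<And>i. i < N \<Longrightarrow> \<bar>ln (a i) - ln (b i)\<bar> \<le> D"
  shows "\<bar>ln ((\<Sum>i<N. a i) / real N) - ln ((\<Sum>i<N. b i) / real N)\<bar> \<le> D"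
proof -
  have main: "ln ((\<Sum>i<N. u i) / real N) \<le> ln ((\<Sum>i<N. v i) / real N) + D"
    if "\<And>i. i < N \<Longrightarrow> u i > 0" "\<And>i. i < N \<Longrightarrow> v i > 0"
      "\<And>i. i < N \<Longrightarrow> \<bar>ln (u i) - ln (v i)\<bar> \<le> D" for u v :: "nat \<Rightarrow> real"
  proof -
    have pos: "(\<Sum>i<N. u i) > 0" "(\<Sum>i<N. v i) > 0"
      using assms(1) that by (auto intro!: sum_pos)
    have "u i \<le> v i * exp D" if "i < N" for i
    proof -
      have "ln (u i) \<le> ln (v i) + D" using that \<open>\<And>i. i < N \<Longrightarrow> \<bar>ln (u i) - ln (v i)\<bar> \<le> D\<close>[of i] by auto
      then have "exp (ln (u i)) \<le> exp (ln (v i) + D)" by simp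
      then show ?thesis using that \<open>\<And>i. i < N \<Longrightarrow> u i > 0\<close>[of i] \<open>\<And>i. i < N \<Longrightarrow> v i > 0\<close>[of i]
        by (simp add: exp_add)
    qed
    then have "(\<Sum>i<N. u i) \<le> (\<Sum>i<N. v i) * exp D"
      unfolding sum_distrib_right by (intro sum_mono) auto
    then have "ln ((\<Sum>i<N. u i) / real N) \<le> ln ((\<Sum>i<N. v i) * exp D / real N)"
      using pos assms(1) by (intro ln_mono divide_right_mono) auto
    also have "\<dots> = ln ((\<Sum>i<N. v i) / real N) + D"
      using pos assms(1) by (simp add: ln_mult ln_div)
    finally show ?thesis .
  qed
  have "ln ((\<Sum>i<N. a i) / real N) \<le> ln ((\<Sum>i<N. b i) / real N) + D"
    using assms by (intro main) auto
  moreover have "ln ((\<Sum>i<N. b i) / real N) \<le> ln ((\<Sum>i<N. a i) / real N) + D"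
    using assms by (intro main) (auto simp: abs_minus_commute)
  ultimately show ?thesis by linarith
qed

section \<open>The noise density and its moments\<close>

definition noise_const :: "real \<Rightarrow> real \<Rightarrow> real" where
  "noise_const \<alpha> d = \<alpha> / (2 * d * Gamma (1 / \<alpha>))"

lemma noise_dens_measurable[measurable]: "noise_dens \<alpha> d \<in> borel_measurable borel"
  unfolding noise_dens_def[abs_def] by measurable

context
  fixes \<alpha> d :: real
  assumes alpha: "\<alpha> \<ge> 1" and d: "d > 0"
begin

lemma noise_const_pos: "noise_const \<alpha> d > 0"
  unfolding noise_const_def using alpha d by (auto intro!: divide_pos_pos mult_pos_pos Gamma_real_pos)

lemma noise_dens_eq: "noise_dens \<alpha> d t = exp (ln (noise_const \<alpha> d) - d powr (- \<alpha>) * \<bar>t\<bar> powr \<alpha>)"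
  using noise_const_pos by (simp add: noise_dens_def noise_const_def exp_diff exp_minus field_simps)

lemma noise_dens_pos: "noise_dens \<alpha> d t > 0"
  by (simp add: noise_dens_eq)

lemma ln_noise_dens: "ln (noise_dens \<alpha> d t) = ln (noise_const \<alpha> d) - d powr (- \<alpha>) * \<bar>t\<bar> powr \<alpha>"
  by (simp add: noise_dens_eq)

lemma noise_dens_le: "noise_dens \<alpha> d t \<le> noise_const \<alpha> d"
proof -
  have "noise_dens \<alpha> d t \<le> exp (ln (noise_const \<alpha> d))"
    unfolding noise_dens_eq using d by simp
  then show ?thesis using noise_const_pos by simp
qed

text \<open>The density is even and injective in \<open>\<bar>t\<bar>\<close>. This decides the
  equality case of Gibbs' inequality.\<close>

lemma noise_dens_eq_iff: "noise_dens \<alpha> d s = noise_dens \<alpha> d t \<longleftrightarrow> \<bar>s\<bar> = \<bar>t\<bar>"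
proof
  assume "noise_dens \<alpha> d s = noise_dens \<alpha> d t"
  then have "\<bar>s\<bar> powr \<alpha> = \<bar>t\<bar> powr \<alpha>" using d by (simp add: noise_dens_eq)
  then have "(\<bar>s\<bar> powr \<alpha>) powr (1 / \<alpha>) = (\<bar>t\<bar> powr \<alpha>) powr (1 / \<alpha>)" by simp
  then show "\<bar>s\<bar> = \<bar>t\<bar>" using alpha by (simp add: powr_powr)
qed (simp add: noise_dens_eq)

text \<open>Domination by \<open>f(t/2)\<close> gives all moments of the noise without evaluating any Gamma integral.\<close>

lemma noise_moment_bound:
  assumes q: "q > 0" and K: "K > 0"
  obtains C where "C > 0" "\<And>t. (\<bar>t\<bar> + K) powr q * noise_dens \<alpha> d t \<le> C * noise_dens \<alpha> d (t / 2)"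
proof
  \<comment> \<open>The exponent that separates the two densities:
    \<open>exp (a * \<bar>t\<bar> powr \<alpha>) * f t = f (t / 2)\<close>.\<close>
  define a where "a = d powr (- \<alpha>) * (1 - 2 powr (- \<alpha>))"
  have "2 powr (- \<alpha>) < (1::real)" using alpha by (simp add: powr_minus_divide)
  then have a: "a > 0" using d by (simp add: a_def)
  \<comment> \<open>The factor \<open>exp (a * K + a)\<close> pays for the shift \<open>K\<close>
    and for the 1 in \<open>\<bar>t\<bar> \<le> \<bar>t\<bar> powr \<alpha> + 1\<close>.\<close>
  define C where "C = (q / a) powr q * exp (a * K + a)"
  show "C > 0" using q a by (simp add: C_def)
  show "(\<bar>t\<bar> + K) powr q * noise_dens \<alpha> d t \<le> C * noise_dens \<alpha> d (t / 2)" for t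
  proof -
    have "\<bar>t\<bar> \<le> \<bar>t\<bar> powr \<alpha> + 1"
    proof (cases "\<bar>t\<bar> \<le> 1")
      case False
      then have "\<bar>t\<bar> powr 1 \<le> \<bar>t\<bar> powr \<alpha>" using alpha by (intro powr_mono) auto
      then show ?thesis using False by simp
    qed (simp add: add_increasing)
    then have "a * \<bar>t\<bar> \<le> a * (\<bar>t\<bar> powr \<alpha> + 1)" using a by simp
    then have "exp (a * (\<bar>t\<bar> + K)) \<le> exp (a * K + a + a * \<bar>t\<bar> powr \<alpha>)" by (simp add: algebra_simps)
    then have "(q / a) powr q * exp (a * (\<bar>t\<bar> + K)) \<le> (q / a) powr q * exp (a * K + a + a * \<bar>t\<bar> powr \<alpha>)"
      by (intro mult_left_mono) auto
    moreover have "(\<bar>t\<bar> + K) powr q \<le> (q / a) powr q * exp (a * (\<bar>t\<bar> + K))"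
      using q a K by (intro powr_le_exp) auto
    ultimately have "(\<bar>t\<bar> + K) powr q \<le> C * exp (a * \<bar>t\<bar> powr \<alpha>)"
      by (simp add: C_def exp_add mult_ac)
    then have "(\<bar>t\<bar> + K) powr q * noise_dens \<alpha> d t \<le> C * exp (a * \<bar>t\<bar> powr \<alpha>) * noise_dens \<alpha> d t"
      using noise_dens_pos[of t] by (intro mult_right_mono) auto
    also have "exp (a * \<bar>t\<bar> powr \<alpha>) * noise_dens \<alpha> d t = noise_dens \<alpha> d (t / 2)"
      unfolding noise_dens_eq exp_add[symmetric] a_def
      by (simp add: powr_divide powr_minus_divide algebra_simps)
    then have "C * exp (a * \<bar>t\<bar> powr \<alpha>) * noise_dens \<alpha> d t = C * noise_dens \<alpha> d (t / 2)"
      by (simp add: mult.assoc)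
    finally show ?thesis .
  qed
qed

end

section \<open>The regression model and its joint laws\<close>

locale regression_model = prob_space M for M :: "'a measure" +
  fixes X :: "'a \<Rightarrow> real^'p" and eps Y :: "'a \<Rightarrow> real"
    and fX :: "real^'p \<Rightarrow> real" and \<beta>0 :: "real^'p" and \<alpha> d B :: real
  assumes fX_nonneg: "\<And>x. fX x \<ge> 0"
    and X_dens: "distributed M lborel X (\<lambda>x. ennreal (fX x))"
    and B: "B > 0" and X_bdd: "AE \<omega> in M. norm (X \<omega>) \<le> B"
    and X_hyper: "\<And>v. v \<noteq> 0 \<Longrightarrow> prob {\<omega> \<in> space M. v \<bullet> X \<omega> = 0} = 0"
    and alpha: "\<alpha> \<ge> 1" and d: "d > 0"
    and eps_dens: "distributed M lborel eps (\<lambda>t. ennreal (noise_dens \<alpha> d t))"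
    and indep: "indep_var borel (\<lambda>\<omega>. (X \<omega>, 0::real)) borel (\<lambda>\<omega>. (0::real^'p, eps \<omega>))"
    and Y_def: "\<And>\<omega>. Y \<omega> = \<beta>0 \<bullet> X \<omega> + eps \<omega>"
begin

abbreviation f :: "real \<Rightarrow> real" where "f \<equiv> noise_dens \<alpha> d"
abbreviation c :: real where "c \<equiv> noise_const \<alpha> d"
text \<open>Envelope in the response, uniform over \<open>norm \<beta> \<le> R\<close> and
  \<open>norm x \<le> B\<close>. The summand 1 makes the base at least 1, as the power difference
  bound demands.\<close>

abbreviation V :: "real \<Rightarrow> real \<Rightarrow> real" where "V R y \<equiv> (\<bar>y\<bar> + R * B + 1) powr \<alpha>"

definition lower :: "real \<Rightarrow> real \<Rightarrow> real" where
  "lower R y = exp (ln c - d powr (- \<alpha>) * V R y)"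

text \<open>The density of \<open>\<beta> \<bullet> X + eps\<close>. As an expectation over
  \<open>X\<close> it is directly the mean of the summands of the empirical mixture.\<close>

definition q :: "real^'p \<Rightarrow> real \<Rightarrow> real" where
  "q \<beta> y = expectation (\<lambda>\<omega>. f (y - \<beta> \<bullet> X \<omega>))"

lemmas f_pos = noise_dens_pos[OF alpha d] and f_le = noise_dens_le[OF alpha d]
  and ln_f = ln_noise_dens[OF alpha d] and c_pos = noise_const_pos[OF alpha d]

lemma fX_measurable[measurable]: "fX \<in> borel_measurable borel"
  using distributed_real_measurable[OF _ X_dens] fX_nonneg by simp

lemma X_measurable[measurable]: "X \<in> borel_measurable M"
  using distributed_measurable[OF X_dens] by simp

lemma eps_measurable[measurable]: "eps \<in> borel_measurable M"
  using distributed_measurable[OF eps_dens] by simp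

lemma Y_measurable[measurable]: "Y \<in> borel_measurable M"
  unfolding Y_def[abs_def] by measurable

lemma residual_le:
  assumes "norm \<beta> \<le> R" "norm x \<le> B"
  shows "\<bar>y - \<beta> \<bullet> x\<bar> \<le> \<bar>y\<bar> + R * B + 1"
proof -
  have "\<bar>\<beta> \<bullet> x\<bar> \<le> norm \<beta> * norm x" by (rule Cauchy_Schwarz_ineq2)
  also have "\<dots> \<le> R * B" using assms order_trans[OF norm_ge_zero assms(1)] by (intro mult_mono) auto
  finally show ?thesis by linarith
qed

lemma residual_powr_le:
  assumes "norm \<beta> \<le> R" "norm x \<le> B"
  shows "\<bar>y - \<beta> \<bullet> x\<bar> powr \<alpha> \<le> V R y"
  using residual_le[OF assms] alpha by (intro powr_mono2) auto

lemma f_lower: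
  assumes "norm \<beta> \<le> R" "norm x \<le> B"
  shows "lower R y \<le> f (y - \<beta> \<bullet> x)"
  using residual_powr_le[OF assms, of y] d
  by (simp add: lower_def noise_dens_eq[OF alpha d] mult_left_mono)

lemma lower_pos: "lower R y > 0"
  by (simp add: lower_def)

lemma abs_ln_le:
  assumes "lower R y \<le> s" "s \<le> c"
  shows "\<bar>ln s\<bar> \<le> \<bar>ln c\<bar> + d powr (- \<alpha>) * V R y"
proof -
  have s: "s > 0" using lower_pos assms(1) by (rule less_le_trans)
  have "ln (lower R y) \<le> ln s" using s assms lower_pos by (intro ln_mono) auto
  then have "ln c - d powr (- \<alpha>) * V R y \<le> ln s" by (simp add: lower_def)
  moreover have "ln s \<le> ln c" using s assms by (intro ln_mono) auto
  moreover have "d powr (- \<alpha>) * V R y \<ge> 0" by simp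
  ultimately show ?thesis by linarith
qed

lemma ln_f_lipschitz:
  assumes "norm \<beta> \<le> R" "norm \<beta>' \<le> R" "norm x \<le> B"
  shows "\<bar>ln (f (y - \<beta> \<bullet> x)) - ln (f (y - \<beta>' \<bullet> x))\<bar> \<le> d powr (- \<alpha>) * \<alpha> * B * V R y * dist \<beta> \<beta>'"
proof -
  have R: "R \<ge> 0" using assms(1) norm_ge_zero order_trans by blast
  have "\<bar>\<bar>y - \<beta>' \<bullet> x\<bar> powr \<alpha> - \<bar>y - \<beta> \<bullet> x\<bar> powr \<alpha>\<bar> \<le> \<alpha> * V R y * \<bar>(y - \<beta>' \<bullet> x) - (y - \<beta> \<bullet> x)\<bar>"
    using residual_le assms alpha R B by (intro abs_powr_diff_le) auto
  also have "\<bar>(y - \<beta>' \<bullet> x) - (y - \<beta> \<bullet> x)\<bar> = \<bar>(\<beta> - \<beta>') \<bullet> x\<bar>" by (simp add: inner_diff_left)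
  also have "\<dots> \<le> norm (\<beta> - \<beta>') * norm x" by (rule Cauchy_Schwarz_ineq2)
  also have "\<dots> \<le> dist \<beta> \<beta>' * B" using assms by (auto simp: dist_norm intro: mult_left_mono)
  finally have "\<bar>\<bar>y - \<beta>' \<bullet> x\<bar> powr \<alpha> - \<bar>y - \<beta> \<bullet> x\<bar> powr \<alpha>\<bar> \<le> \<alpha> * V R y * (dist \<beta> \<beta>' * B)"
    using alpha by (simp add: mult_left_mono)
  then have "d powr (- \<alpha>) * \<bar>\<bar>y - \<beta>' \<bullet> x\<bar> powr \<alpha> - \<bar>y - \<beta> \<bullet> x\<bar> powr \<alpha>\<bar>
      \<le> d powr (- \<alpha>) * (\<alpha> * V R y * (dist \<beta> \<beta>' * B))" by (intro mult_left_mono) auto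
  moreover have "\<bar>ln (f (y - \<beta> \<bullet> x)) - ln (f (y - \<beta>' \<bullet> x))\<bar>
      = \<bar>d powr (- \<alpha>) * (\<bar>y - \<beta>' \<bullet> x\<bar> powr \<alpha> - \<bar>y - \<beta> \<bullet> x\<bar> powr \<alpha>)\<bar>"
    by (simp add: ln_f right_diff_distrib)
  ultimately show ?thesis by (simp add: abs_mult mult_ac)
qed

lemma integrable_f_residual[simp]: "integrable M (\<lambda>\<omega>. f (y - \<beta> \<bullet> X \<omega>))"
  using f_le f_pos by (intro integrable_const_bound[where B=c]) (auto simp: less_imp_le abs_of_pos)

lemma q_measurable[measurable]: "q \<beta> \<in> borel_measurable borel"
  unfolding q_def[abs_def] by measurable

lemma q_le: "q \<beta> y \<le> c"
  unfolding q_def using f_le by (intro integral_le_const) auto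

lemma q_ge:
  assumes "norm \<beta> \<le> R"
  shows "lower R y \<le> q \<beta> y"
  unfolding q_def using X_bdd f_lower[OF assms] by (intro integral_ge_const) auto

lemma q_pos: "q \<beta> y > 0"
  using q_ge[OF order_refl] lower_pos by (rule less_le_trans[rotated])

lemma q_eq_lborel: "(LINT x|lborel. f (y - \<beta> \<bullet> x) * fX x) = q \<beta> y"
  unfolding q_def
  by (subst distributed_integral[OF X_dens, symmetric]) (auto simp: fX_nonneg mult.commute)

lemma integrable_f_fX: "integrable lborel (\<lambda>x. f (y - \<beta> \<bullet> x) * fX x)"
  using distributed_integrable[OF X_dens, of "\<lambda>x. f (y - \<beta> \<bullet> x)"]
  by (auto simp: fX_nonneg mult.commute)

lemma dens_Y_eq: "dens_Y \<alpha> d \<beta>0 fX = q \<beta>0"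
  by (auto simp: dens_Y_def q_eq_lborel)

text \<open>Independence is stated for maps into one common space, so \<open>X\<close> and
  \<open>eps\<close> come padded with zeros. Pushing the product law forward along
  \<open>(u, w)\<close> to \<open>(fst u, snd w)\<close> strips the padding.\<close>

lemma joint_X_eps:
  "distributed M (lborel \<Otimes>\<^sub>M lborel) (\<lambda>\<omega>. (X \<omega>, eps \<omega>)) (\<lambda>(x, t). ennreal (fX x) * ennreal (f t))"
proof (rule distributed_joint_indep'[OF _ _ X_dens eps_dens])
  let ?U = "\<lambda>\<omega>. (X \<omega>, 0::real)" and ?W = "\<lambda>\<omega>. (0::real^'p, eps \<omega>)"
  have [measurable]: "fst \<in> borel_measurable (borel :: ((real^'p) \<times> real) measure)"
    "snd \<in> borel_measurable (borel :: ((real^'p) \<times> real) measure)"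
    by (intro borel_measurable_continuous_onI continuous_intros)+
  have [measurable]: "?U \<in> borel_measurable M" "?W \<in> borel_measurable M" by measurable
  \<comment> \<open>The product of image measures is an image of the product once the second factor
    is sigma-finite.\<close>
  have W: "prob_space (distr (distr M borel ?W) lborel snd)"
    by (intro prob_space.prob_space_distr prob_space_distr prob_space_axioms) auto
  have "distr M lborel X \<Otimes>\<^sub>M distr M lborel eps
      = distr (distr M borel ?U) lborel fst \<Otimes>\<^sub>M distr (distr M borel ?W) lborel snd"
    by (simp add: distr_distr comp_def)
  also have "\<dots> = distr (distr M borel ?U \<Otimes>\<^sub>M distr M borel ?W) (lborel \<Otimes>\<^sub>M lborel) (\<lambda>(u :: (real^'p) \<times> real, w :: (real^'p) \<times> real). (fst u, snd w))"
    using W by (intro pair_measure_distr prob_space_imp_sigma_finite) auto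
  also have "distr M borel ?U \<Otimes>\<^sub>M distr M borel ?W = distr M (borel \<Otimes>\<^sub>M borel) (\<lambda>\<omega>. (?U \<omega>, ?W \<omega>))"
    using indep unfolding indep_var_distribution_eq by blast
  also have "distr \<dots> (lborel \<Otimes>\<^sub>M lborel) (\<lambda>(u :: (real^'p) \<times> real, w :: (real^'p) \<times> real). (fst u, snd w)) = distr M (lborel \<Otimes>\<^sub>M lborel) (\<lambda>\<omega>. (X \<omega>, eps \<omega>))"
  proof (subst distr_distr)
    have "(\<lambda>p :: ((real^'p) \<times> real) \<times> ((real^'p) \<times> real). (fst (fst p), snd (snd p))) \<in> borel \<Otimes>\<^sub>M borel \<rightarrow>\<^sub>M (lborel :: (real^'p) measure) \<Otimes>\<^sub>M (lborel :: real measure)"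
      by (intro measurable_Pair) simp_all
    then show "(\<lambda>(u :: (real^'p) \<times> real, w :: (real^'p) \<times> real). (fst u, snd w)) \<in> borel \<Otimes>\<^sub>M borel \<rightarrow>\<^sub>M (lborel :: (real^'p) measure) \<Otimes>\<^sub>M (lborel :: real measure)"
      by (simp add: split_beta')
  qed (auto simp: comp_def)
  finally show "distr M lborel X \<Otimes>\<^sub>M distr M lborel eps = distr M (lborel \<Otimes>\<^sub>M lborel) (\<lambda>\<omega>. (X \<omega>, eps \<omega>))" .
qed (rule lborel.sigma_finite_measure_axioms)+

lemma nn_integral_X_eps:
  assumes [measurable]: "g \<in> borel_measurable (borel \<Otimes>\<^sub>M borel)"
  shows "(\<integral>\<^sup>+\<omega>. g (X \<omega>, eps \<omega>) \<partial>M) = (\<integral>\<^sup>+x. ennreal (fX x) * (\<integral>\<^sup>+t. ennreal (f t) * g (x, t) \<partial>lborel) \<partial>lborel)"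
proof -
  have "(\<integral>\<^sup>+\<omega>. g (X \<omega>, eps \<omega>) \<partial>M)
      = (\<integral>\<^sup>+p. (case p of (x, t) \<Rightarrow> ennreal (fX x) * ennreal (f t)) * g p \<partial>(lborel \<Otimes>\<^sub>M lborel))"
    by (rule distributed_nn_integral[OF joint_X_eps, symmetric]) simp
  also have "\<dots> = (\<integral>\<^sup>+x. \<integral>\<^sup>+t. ennreal (fX x) * ennreal (f t) * g (x, t) \<partial>lborel \<partial>lborel)"
    by (subst lborel.nn_integral_fst[symmetric]) auto
  also have "\<dots> = (\<integral>\<^sup>+x. ennreal (fX x) * (\<integral>\<^sup>+t. ennreal (f t) * g (x, t) \<partial>lborel) \<partial>lborel)"
    by (simp add: mult.assoc nn_integral_cmult)
  finally show ?thesis .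
qed

lemma nn_integral_shift:
  assumes [measurable]: "g \<in> borel_measurable (borel :: real measure)"
  shows "(\<integral>\<^sup>+t. g t \<partial>lborel) = (\<integral>\<^sup>+t. g (t - s) \<partial>lborel)"
  using nn_integral_real_affine[OF assms, of 1 "- s"] by simp

text \<open>For fixed \<open>x\<close> the substitution \<open>t = y - \<beta>0 \<bullet> x\<close>
  is a translation. For nonnegative integrands no integrability has to be known, which is how the
  likelihood ratios are later seen to have mean 1.\<close>

lemma nn_integral_X_Y:
  assumes [measurable]: "g \<in> borel_measurable (borel \<Otimes>\<^sub>M borel)"
  shows "(\<integral>\<^sup>+\<omega>. g (X \<omega>, Y \<omega>) \<partial>M)
    = (\<integral>\<^sup>+x. ennreal (fX x) * (\<integral>\<^sup>+y. ennreal (f (y - \<beta>0 \<bullet> x)) * g (x, y) \<partial>lborel) \<partial>lborel)"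
proof -
  have "(\<integral>\<^sup>+\<omega>. g (X \<omega>, Y \<omega>) \<partial>M)
      = (\<integral>\<^sup>+x. ennreal (fX x) * (\<integral>\<^sup>+t. ennreal (f t) * g (x, \<beta>0 \<bullet> x + t) \<partial>lborel) \<partial>lborel)"
    unfolding Y_def by (rule nn_integral_X_eps[of "\<lambda>(x, t). g (x, \<beta>0 \<bullet> x + t)", simplified]) measurable
  also have "\<dots> = (\<integral>\<^sup>+x. ennreal (fX x) * (\<integral>\<^sup>+y. ennreal (f (y - \<beta>0 \<bullet> x)) * g (x, y) \<partial>lborel) \<partial>lborel)"
  proof (rule nn_integral_cong, rule arg_cong2[where f="(*)"], rule refl)
    fix x
    show "(\<integral>\<^sup>+t. ennreal (f t) * g (x, \<beta>0 \<bullet> x + t) \<partial>lborel)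
      = (\<integral>\<^sup>+y. ennreal (f (y - \<beta>0 \<bullet> x)) * g (x, y) \<partial>lborel)"
      by (subst nn_integral_shift[of _ "\<beta>0 \<bullet> x"]) auto
  qed
  finally show ?thesis .
qed

lemma joint_X_Y:
  "distributed M (lborel \<Otimes>\<^sub>M lborel) (\<lambda>\<omega>. (X \<omega>, Y \<omega>)) (\<lambda>(x, y). ennreal (f (y - \<beta>0 \<bullet> x) * fX x))"
  unfolding distributed_def
proof (intro conjI measure_eqI)
  fix A assume "A \<in> sets (distr M (lborel \<Otimes>\<^sub>M lborel) (\<lambda>\<omega>. (X \<omega>, Y \<omega>)))"
  then have [measurable]: "A \<in> sets (borel \<Otimes>\<^sub>M borel)" 
    by (simp cong: sets_pair_measure_cong)
  then have [measurable]: "A \<in> sets (lborel \<Otimes>\<^sub>M lborel)" by (simp cong: sets_pair_measure_cong)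
  have "emeasure (distr M (lborel \<Otimes>\<^sub>M lborel) (\<lambda>\<omega>. (X \<omega>, Y \<omega>))) A = (\<integral>\<^sup>+\<omega>. indicator A (X \<omega>, Y \<omega>) \<partial>M)"
    by (simp flip: nn_integral_indicator add: nn_integral_distr)
  also have "\<dots> = (\<integral>\<^sup>+x. \<integral>\<^sup>+y. ennreal (f (y - \<beta>0 \<bullet> x) * fX x) * indicator A (x, y) \<partial>lborel \<partial>lborel)"
    using f_pos fX_nonneg
    by (simp add: nn_integral_X_Y nn_integral_cmult[symmetric] ennreal_mult' less_imp_le mult_ac)
  also have "\<dots> = emeasure (density (lborel \<Otimes>\<^sub>M lborel) (\<lambda>(x, y). ennreal (f (y - \<beta>0 \<bullet> x) * fX x))) A"
    by (simp add: emeasure_density lborel.nn_integral_fst[symmetric])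
  finally show "emeasure (distr M (lborel \<Otimes>\<^sub>M lborel) (\<lambda>\<omega>. (X \<omega>, Y \<omega>))) A
      = emeasure (density (lborel \<Otimes>\<^sub>M lborel) (\<lambda>(x, y). ennreal (f (y - \<beta>0 \<bullet> x) * fX x))) A" .
qed auto

lemma Y_dens: "distributed M lborel Y (\<lambda>y. ennreal (q \<beta>0 y))"
proof -
  have "distributed M lborel Y (\<lambda>y. \<integral>\<^sup>+x. ennreal (f (y - \<beta>0 \<bullet> x) * fX x) \<partial>lborel)"
    using distr_marginal2[OF lborel.sigma_finite_measure_axioms lborel.sigma_finite_measure_axioms joint_X_Y]
    by simp
  also have "(\<lambda>y. \<integral>\<^sup>+x. ennreal (f (y - \<beta>0 \<bullet> x) * fX x) \<partial>lborel) = (\<lambda>y. ennreal (q \<beta>0 y))"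
    using f_pos fX_nonneg integrable_f_fX
    by (auto simp: nn_integral_eq_integral q_eq_lborel less_imp_le)
  finally show ?thesis .
qed

end

section \<open>The population criterion\<close>

text \<open>\<open>W\<close> stands for a likelihood ratio. The variable \<open>W - 1 - ln W\<close>
  is nonnegative, vanishes only at \<open>W = 1\<close>, and has mean
  \<open>- expectation (ln W)\<close> because \<open>W\<close> has mean 1.\<close>

lemma (in prob_space) gibbs_inequality:
  fixes W :: "'a \<Rightarrow> real"
  assumes [measurable]: "W \<in> borel_measurable M" and pos: "\<And>\<omega>. W \<omega> > 0"
    and one: "(\<integral>\<^sup>+\<omega>. ennreal (W \<omega>) \<partial>M) = 1" and int: "integrable M (\<lambda>\<omega>. ln (W \<omega>))"
  shows "expectation (\<lambda>\<omega>. ln (W \<omega>)) \<le> 0"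
    and "expectation (\<lambda>\<omega>. ln (W \<omega>)) = 0 \<Longrightarrow> AE \<omega> in M. W \<omega> = 1"
proof -
  have iW: "integrable M W"
    using pos one by (intro integrableI_nonneg) (auto simp: less_imp_le)
  have EW: "expectation W = 1"
    using pos one by (subst integral_eq_nn_integral) (auto simp: less_imp_le)
  have nonneg: "0 \<le> W \<omega> - 1 - ln (W \<omega>)" for \<omega>
    using ln_le_minus_one[OF pos[of \<omega>]] by simp
  have i: "integrable M (\<lambda>\<omega>. W \<omega> - 1 - ln (W \<omega>))" using iW int by simp
  have E: "expectation (\<lambda>\<omega>. W \<omega> - 1 - ln (W \<omega>)) = - expectation (\<lambda>\<omega>. ln (W \<omega>))"
    using iW int EW by (simp add: prob_space)
  show "expectation (\<lambda>\<omega>. ln (W \<omega>)) \<le> 0"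
    using E Bochner_Integration.integral_nonneg[of M "\<lambda>\<omega>. W \<omega> - 1 - ln (W \<omega>)", OF nonneg] by simp
  assume "expectation (\<lambda>\<omega>. ln (W \<omega>)) = 0"
  with E have "AE \<omega> in M. W \<omega> - 1 - ln (W \<omega>) = 0"
    using integral_nonneg_eq_0_iff_AE[OF i] nonneg by simp
  then show "AE \<omega> in M. W \<omega> = 1"
  proof eventually_elim
    case (elim \<omega>)
    then show ?case using ln_eq_minus_one[OF pos[of \<omega>]] by simp
  qed
qed

context regression_model
begin

lemma nn_integral_f_shift: "(\<integral>\<^sup>+t. ennreal (f (t - s)) \<partial>lborel) = 1"
proof -
  have "(\<integral>\<^sup>+t. ennreal (f (t - s)) \<partial>lborel) = (\<integral>\<^sup>+t. ennreal (f t) \<partial>lborel)"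
    by (subst (2) nn_integral_shift[of _ s]) auto
  also have "\<dots> = 1"
    using distributed_nn_integral[OF eps_dens, of "\<lambda>_. 1"] by (simp add: emeasure_space_1)
  finally show ?thesis .
qed

lemma nn_integral_fX: "(\<integral>\<^sup>+x. ennreal (fX x) \<partial>lborel) = 1"
  using distributed_nn_integral[OF X_dens, of "\<lambda>_. 1"] by (simp add: emeasure_space_1)

text \<open>Any \<open>\<beta>\<close> may play the role of the true parameter:
  \<open>q \<beta>\<close> is the response density of the model with regression vector
  \<open>\<beta>\<close>.\<close>

lemma nn_integral_q: "(\<integral>\<^sup>+y. ennreal (q \<beta> y) \<partial>lborel) = 1"
proof -
  interpret other: regression_model M X eps "\<lambda>\<omega>. \<beta> \<bullet> X \<omega> + eps \<omega>" fX \<beta> \<alpha> d B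
    by unfold_locales (fact fX_nonneg X_dens B X_bdd X_hyper alpha d eps_dens indep refl)+
  show ?thesis
    using distributed_nn_integral[OF other.Y_dens, of "\<lambda>_. 1"] by (simp add: emeasure_space_1)
qed

section \<open>Moments and integrability\<close>

lemma integrable_eps_powr:
  assumes "r > 0" "K > 0"
  shows "integrable M (\<lambda>\<omega>. (\<bar>eps \<omega>\<bar> + K) powr r)"
proof -
  have "integrable lborel f"
    using distributed_integrable[OF eps_dens, of "\<lambda>_. 1"] f_pos by (simp add: less_imp_le)
  from lborel_integrable_real_affine[OF this, of "1/2" 0]
  have i: "integrable lborel (\<lambda>t. f (t / 2))" by simp
  obtain C where C: "C > 0" "\<And>t. (\<bar>t\<bar> + K) powr r * f t \<le> C * f (t / 2)"
    using noise_moment_bound[OF alpha d assms] by blast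
  have "integrable lborel (\<lambda>t. f t * (\<bar>t\<bar> + K) powr r)"
  proof (rule Bochner_Integration.integrable_bound)
    show "integrable lborel (\<lambda>t. C * f (t / 2))" using i by simp
    show "AE t in lborel. norm (f t * (\<bar>t\<bar> + K) powr r) \<le> norm (C * f (t / 2))"
      using C f_pos by (intro AE_I2) (simp add: abs_mult less_imp_le abs_of_pos mult.commute)
  qed measurable
  then show ?thesis
    using distributed_integrable[OF eps_dens, of "\<lambda>t. (\<bar>t\<bar> + K) powr r"] f_pos
    by (simp add: less_imp_le)
qed

lemma abs_Y_le: "AE \<omega> in M. \<bar>Y \<omega>\<bar> \<le> \<bar>eps \<omega>\<bar> + norm \<beta>0 * B"
  using X_bdd
proof eventually_elim
  case (elim \<omega>)
  have "\<bar>\<beta>0 \<bullet> X \<omega>\<bar> \<le> norm \<beta>0 * norm (X \<omega>)" by (rule Cauchy_Schwarz_ineq2)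
  also have "\<dots> \<le> norm \<beta>0 * B" using elim by (intro mult_left_mono) auto
  finally show ?case by (simp add: Y_def)
qed

lemma integrable_V_square:
  assumes "R \<ge> 0"
  shows "integrable M (\<lambda>\<omega>. (V R (Y \<omega>))\<^sup>2)"
proof (rule Bochner_Integration.integrable_bound)
  \<comment> \<open>Absorbs the bound \<open>norm \<beta>0 * B\<close> for the signal, so that
    \<open>\<bar>Y\<bar> + R * B + 1 \<le> \<bar>eps\<bar> + K\<close> almost surely.\<close>
  define K where "K = norm \<beta>0 * B + R * B + 1"
  have K: "K > 0" using assms B by (simp add: K_def add_nonneg_pos)
  then show "integrable M (\<lambda>\<omega>. (\<bar>eps \<omega>\<bar> + K) powr (2 * \<alpha>))"
    using alpha by (intro integrable_eps_powr) auto
  show "AE \<omega> in M. norm ((V R (Y \<omega>))\<^sup>2) \<le> norm ((\<bar>eps \<omega>\<bar> + K) powr (2 * \<alpha>))"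
    using abs_Y_le
  proof eventually_elim
    case (elim \<omega>)
    have "0 \<le> \<bar>Y \<omega>\<bar> + R * B + 1" using assms B by simp
    then have "(\<bar>Y \<omega>\<bar> + R * B + 1) powr (2 * \<alpha>) \<le> (\<bar>eps \<omega>\<bar> + K) powr (2 * \<alpha>)"
      using elim alpha by (intro powr_mono2) (auto simp: K_def)
    then show ?case by (simp add: power2_eq_square flip: powr_add)
  qed
qed measurable

lemma integrable_V:
  assumes "R \<ge> 0"
  shows "integrable M (\<lambda>\<omega>. V R (Y \<omega>))"
  by (rule L1_le_sqrt_L2(1)) (use integrable_V_square[OF assms] in auto)

text \<open>The weak law asks for second moments. The log terms and the powers of \<open>Y\<close>
  are bounded by affine functions of \<open>V\<close>, so this one criterion serves them
  all.\<close>

lemma dominated_square_integrable: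
  fixes g :: "'a \<Rightarrow> real"
  assumes "R \<ge> 0" and [measurable]: "g \<in> borel_measurable M" and a: "a \<ge> 0" and b: "b \<ge> 0"
    and le: "AE \<omega> in M. \<bar>g \<omega>\<bar> \<le> a + b * V R (Y \<omega>)"
  shows "integrable M (\<lambda>\<omega>. (g \<omega>)\<^sup>2)" "integrable M g"
proof -
  show i: "integrable M (\<lambda>\<omega>. (g \<omega>)\<^sup>2)"
  proof (rule Bochner_Integration.integrable_bound)
    show "integrable M (\<lambda>\<omega>. 2 * a\<^sup>2 + 2 * b\<^sup>2 * (V R (Y \<omega>))\<^sup>2)"
      using integrable_V_square[OF assms(1)] by simp
    show "AE \<omega> in M. norm ((g \<omega>)\<^sup>2) \<le> norm (2 * a\<^sup>2 + 2 * b\<^sup>2 * (V R (Y \<omega>))\<^sup>2)"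
      using le
    proof eventually_elim
      case (elim \<omega>)
      have "(g \<omega>)\<^sup>2 \<le> (a + b * V R (Y \<omega>))\<^sup>2" using elim by (intro abs_le_square_iff[THEN iffD1]) auto
      also have "\<dots> \<le> 2 * a\<^sup>2 + 2 * b\<^sup>2 * (V R (Y \<omega>))\<^sup>2"
        using zero_le_power2[of "a - b * V R (Y \<omega>)"]
        by (simp add: power2_eq_square algebra_simps)
      finally show ?case by simp
    qed
  qed measurable
  show "integrable M g" by (rule L1_le_sqrt_L2(1)) (use i in auto)
qed

lemma ln_q_dominated: "norm \<beta> \<le> R \<Longrightarrow> \<bar>ln (q \<beta> y)\<bar> \<le> \<bar>ln c\<bar> + d powr (- \<alpha>) * V R y"
  by (intro abs_ln_le q_ge q_le)

lemma ln_f_dominated: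
  "norm \<beta> \<le> R \<Longrightarrow> norm x \<le> B \<Longrightarrow> \<bar>ln (f (y - \<beta> \<bullet> x))\<bar> \<le> \<bar>ln c\<bar> + d powr (- \<alpha>) * V R y"
  by (intro abs_ln_le f_lower f_le)

lemma
  shows integrable_ln_q_square: "integrable M (\<lambda>\<omega>. (ln (q \<beta> (Y \<omega>)))\<^sup>2)"
    and integrable_ln_q: "integrable M (\<lambda>\<omega>. ln (q \<beta> (Y \<omega>)))"
    and integrable_ln_f_square: "integrable M (\<lambda>\<omega>. (ln (f (Y \<omega> - \<beta> \<bullet> X \<omega>)))\<^sup>2)"
    and integrable_ln_f: "integrable M (\<lambda>\<omega>. ln (f (Y \<omega> - \<beta> \<bullet> X \<omega>)))"
proof -
  have q: "AE \<omega> in M. \<bar>ln (q \<beta> (Y \<omega>))\<bar> \<le> \<bar>ln c\<bar> + d powr (- \<alpha>) * V (norm \<beta>) (Y \<omega>)"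
    by (simp add: ln_q_dominated)
  have f: "AE \<omega> in M. \<bar>ln (f (Y \<omega> - \<beta> \<bullet> X \<omega>))\<bar> \<le> \<bar>ln c\<bar> + d powr (- \<alpha>) * V (norm \<beta>) (Y \<omega>)"
    using X_bdd by eventually_elim (simp add: ln_f_dominated)
  show "integrable M (\<lambda>\<omega>. (ln (q \<beta> (Y \<omega>)))\<^sup>2)" "integrable M (\<lambda>\<omega>. ln (q \<beta> (Y \<omega>)))"
    by (rule dominated_square_integrable[OF _ _ _ _ q]; simp)+
  show "integrable M (\<lambda>\<omega>. (ln (f (Y \<omega> - \<beta> \<bullet> X \<omega>)))\<^sup>2)" "integrable M (\<lambda>\<omega>. ln (f (Y \<omega> - \<beta> \<bullet> X \<omega>)))"
    by (rule dominated_square_integrable[OF _ _ _ _ f]; simp)+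
qed

text \<open>Stated for an arbitrary bounded \<open>Z\<close>, since it is applied both to
  \<open>X\<close> and to the sampled \<open>Xs i\<close>.\<close>

lemma
  fixes Z :: "'a \<Rightarrow> real^'p"
  assumes "AE \<omega> in M. norm (Z \<omega>) \<le> B" and [measurable]: "Z \<in> borel_measurable M"
  shows integrable_inner_powr_square: "integrable M (\<lambda>\<omega>. (\<bar>u \<bullet> Z \<omega>\<bar> powr \<alpha>)\<^sup>2)"
    and integrable_inner_powr: "integrable M (\<lambda>\<omega>. \<bar>u \<bullet> Z \<omega>\<bar> powr \<alpha>)"
proof -
  have bd: "AE \<omega> in M. \<bar>u \<bullet> Z \<omega>\<bar> powr \<alpha> \<le> (norm u * B) powr \<alpha>"
    using assms(1)
  proof eventually_elim
    case (elim \<omega>)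
    have "\<bar>u \<bullet> Z \<omega>\<bar> \<le> norm u * norm (Z \<omega>)" by (rule Cauchy_Schwarz_ineq2)
    also have "\<dots> \<le> norm u * B" using elim by (intro mult_left_mono) auto
    finally show ?case using alpha by (intro powr_mono2) auto
  qed
  show i: "integrable M (\<lambda>\<omega>. (\<bar>u \<bullet> Z \<omega>\<bar> powr \<alpha>)\<^sup>2)"
  proof (rule integrable_const_bound)
    show "AE \<omega> in M. norm ((\<bar>u \<bullet> Z \<omega>\<bar> powr \<alpha>)\<^sup>2) \<le> ((norm u * B) powr \<alpha>)\<^sup>2"
      using bd by eventually_elim (simp add: power_mono)
  qed measurable
  show "integrable M (\<lambda>\<omega>. \<bar>u \<bullet> Z \<omega>\<bar> powr \<alpha>)"
    by (rule L1_le_sqrt_L2(1)) (use i in auto)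
qed

lemma integrable_Y_powr_square: "integrable M (\<lambda>\<omega>. (\<bar>Y \<omega>\<bar> powr \<alpha>)\<^sup>2)"
  and integrable_Y_powr: "integrable M (\<lambda>\<omega>. \<bar>Y \<omega>\<bar> powr \<alpha>)"
proof -
  have le: "AE \<omega> in M. \<bar>\<bar>Y \<omega>\<bar> powr \<alpha>\<bar> \<le> 0 + 1 * V 0 (Y \<omega>)"
    using alpha by (auto intro!: powr_mono2)
  show "integrable M (\<lambda>\<omega>. (\<bar>Y \<omega>\<bar> powr \<alpha>)\<^sup>2)" "integrable M (\<lambda>\<omega>. \<bar>Y \<omega>\<bar> powr \<alpha>)"
    by (rule dominated_square_integrable[OF _ _ _ _ le]; simp)+
qed

text \<open>Given \<open>X\<close>, the noise has a density and charges no single point, so the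
  graph of \<open>g\<close> is null by Tonelli. It is used for \<open>Y \<noteq> 0\<close> and to
  exclude residuals that are mirror images of each other.\<close>

lemma eps_neq:
  assumes [measurable]: "g \<in> borel_measurable borel"
  shows "AE \<omega> in M. eps \<omega> \<noteq> g (X \<omega>)"
proof -
  have "(\<integral>\<^sup>+\<omega>. indicator {p. snd p = g (fst p)} (X \<omega>, eps \<omega>) \<partial>M)
      = (\<integral>\<^sup>+x. ennreal (fX x) * (\<integral>\<^sup>+t. ennreal (f t) * indicator {p. snd p = g (fst p)} (x, t) \<partial>lborel) \<partial>lborel)"
    by (rule nn_integral_X_eps) measurable
  also have "\<dots> = (\<integral>\<^sup>+x. ennreal (fX x) * (\<integral>\<^sup>+t. ennreal (f t) * indicator {g x} t \<partial>lborel) \<partial>lborel)"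
    by (simp add: indicator_def)
  also have "\<dots> = 0"
  proof -
    have "(\<integral>\<^sup>+t. ennreal (f t) * indicator {g x} t \<partial>lborel) = 0" for x
      by (subst nn_integral_indicator_singleton) auto
    then show ?thesis by simp
  qed
  finally have "(\<integral>\<^sup>+\<omega>. indicator {p. snd p = g (fst p)} (X \<omega>, eps \<omega>) \<partial>M) = 0" by simp
  then have "AE \<omega> in M. (indicator {p. snd p = g (fst p)} (X \<omega>, eps \<omega>) :: ennreal) = 0"
    by (subst (asm) nn_integral_0_iff_AE) measurable
  then show ?thesis by eventually_elim (auto simp: indicator_def split: if_splits)
qed

text \<open>Strict positivity lets a fixed fraction of this moment serve as the tolerance when the
  maximizer is confined.\<close>

lemma expectation_Y_powr_pos: "expectation (\<lambda>\<omega>. \<bar>Y \<omega>\<bar> powr \<alpha>) > 0"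
proof -
  have "expectation (\<lambda>\<omega>. \<bar>Y \<omega>\<bar> powr \<alpha>) \<noteq> 0"
  proof
    assume "expectation (\<lambda>\<omega>. \<bar>Y \<omega>\<bar> powr \<alpha>) = 0"
    then have "AE \<omega> in M. \<bar>Y \<omega>\<bar> powr \<alpha> = 0"
      using integral_nonneg_eq_0_iff_AE[OF integrable_Y_powr] by simp
    moreover have "AE \<omega> in M. eps \<omega> \<noteq> - (\<beta>0 \<bullet> X \<omega>)" by (rule eps_neq) simp
    ultimately have "AE \<omega> in M. False" by eventually_elim (simp add: Y_def)
    then show False by simp
  qed
  moreover have "expectation (\<lambda>\<omega>. \<bar>Y \<omega>\<bar> powr \<alpha>) \<ge> 0"
    by (intro Bochner_Integration.integral_nonneg) simp
  ultimately show ?thesis by linarith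
qed

section \<open>Nondegeneracy of the covariate in all directions\<close>

lemma inner_X_neq_0:
  assumes "u \<noteq> 0"
  shows "AE \<omega> in M. u \<bullet> X \<omega> \<noteq> 0"
  using X_hyper[OF assms] by (subst (asm) prob_eq_0) simp_all

text \<open>A deterministic modulus in the direction, used twice: for continuity of the directional
  moments and for the uniform law on the sphere. The base \<open>B + 1\<close> is at least 1 and
  dominates the inner products.\<close>

lemma inner_powr_lipschitz:
  assumes "norm u \<le> 1" "norm v \<le> 1" "norm x \<le> B"
  shows "\<bar>\<bar>u \<bullet> x\<bar> powr \<alpha> - \<bar>v \<bullet> x\<bar> powr \<alpha>\<bar> \<le> \<alpha> * (B + 1) powr \<alpha> * B * dist u v"
proof -
  have le: "\<bar>w \<bullet> x\<bar> \<le> norm w * B" for w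
  proof -
    have "\<bar>w \<bullet> x\<bar> \<le> norm w * norm x" by (rule Cauchy_Schwarz_ineq2)
    also have "\<dots> \<le> norm w * B" using assms by (intro mult_left_mono) auto
    finally show ?thesis .
  qed
  have le1: "\<bar>w \<bullet> x\<bar> \<le> B + 1" if "norm w \<le> 1" for w
    using le[of w] mult_right_mono[OF that, of B] B by linarith
  have "\<bar>\<bar>u \<bullet> x\<bar> powr \<alpha> - \<bar>v \<bullet> x\<bar> powr \<alpha>\<bar> \<le> \<alpha> * (B + 1) powr \<alpha> * \<bar>u \<bullet> x - v \<bullet> x\<bar>"
    using assms alpha B by (intro abs_powr_diff_le le1) auto
  also have "\<dots> \<le> \<alpha> * (B + 1) powr \<alpha> * (norm (u - v) * B)"
    using le[of "u - v"] alpha by (intro mult_left_mono) (auto simp: inner_diff_left)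
  finally show ?thesis by (simp add: dist_norm mult_ac)
qed

text \<open>Each direction has a positive moment because hyperplanes through 0 are null for
  \<open>X\<close>. Continuity on the compact sphere makes the infimum a minimum, hence
  positive.\<close>

lemma Inf_expectation_inner_powr_pos:
  "(INF u\<in>{u::real^'p. norm u = 1}. expectation (\<lambda>\<omega>. \<bar>u \<bullet> X \<omega>\<bar> powr \<alpha>)) > 0"
proof -
  let ?g = "\<lambda>u. expectation (\<lambda>\<omega>. \<bar>u \<bullet> X \<omega>\<bar> powr \<alpha>)"
  let ?S = "{u::real^'p. norm u = 1}"
  note int = integrable_inner_powr[OF X_bdd X_measurable]
  have S: "?S = sphere 0 1" by auto
  have "\<bar>?g u - ?g v\<bar> \<le> \<alpha> * (B + 1) powr \<alpha> * B * dist u v" if "u \<in> ?S" "v \<in> ?S" for u v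
  proof -
    have "\<bar>?g u - ?g v\<bar> = \<bar>expectation (\<lambda>\<omega>. \<bar>u \<bullet> X \<omega>\<bar> powr \<alpha> - \<bar>v \<bullet> X \<omega>\<bar> powr \<alpha>)\<bar>"
      using int by simp
    also have "\<dots> \<le> expectation (\<lambda>\<omega>. \<bar>\<bar>u \<bullet> X \<omega>\<bar> powr \<alpha> - \<bar>v \<bullet> X \<omega>\<bar> powr \<alpha>\<bar>)"
      by (rule integral_abs_bound)
    also have "\<dots> \<le> \<alpha> * (B + 1) powr \<alpha> * B * dist u v"
    proof (intro integral_le_const)
      show "AE \<omega> in M. \<bar>\<bar>u \<bullet> X \<omega>\<bar> powr \<alpha> - \<bar>v \<bullet> X \<omega>\<bar> powr \<alpha>\<bar> \<le> \<alpha> * (B + 1) powr \<alpha> * B * dist u v"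
        using X_bdd by eventually_elim (use that in \<open>auto intro!: inner_powr_lipschitz\<close>)
    qed (use int in auto)
    finally show ?thesis .
  qed
  then have "(\<alpha> * (B + 1) powr \<alpha> * B)-lipschitz_on ?S ?g"
    using alpha B by (intro lipschitz_onI) (auto simp: dist_real_def)
  then have "continuous_on ?S ?g" by (rule lipschitz_on_continuous_on)
  moreover have "compact ?S" "?S \<noteq> {}" unfolding S by (auto simp: sphere_eq_empty)
  ultimately obtain u where u: "u \<in> ?S" "\<And>v. v \<in> ?S \<Longrightarrow> ?g u \<le> ?g v"
    using continuous_attains_inf[of ?S ?g] by blast
  have "?g u \<noteq> 0"
  proof
    assume "?g u = 0"
    then have "AE \<omega> in M. \<bar>u \<bullet> X \<omega>\<bar> powr \<alpha> = 0"
      using integral_nonneg_eq_0_iff_AE[OF int] by simp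
    moreover have "AE \<omega> in M. u \<bullet> X \<omega> \<noteq> 0" using u(1) by (intro inner_X_neq_0) auto
    ultimately have "AE \<omega> in M. False" by eventually_elim simp
    then show False by simp
  qed
  moreover have "?g u \<ge> 0" by (intro Bochner_Integration.integral_nonneg) simp
  ultimately have "?g u > 0" by linarith
  also have "?g u \<le> (INF u\<in>?S. ?g u)" using u \<open>?S \<noteq> {}\<close> by (intro cINF_greatest) auto
  finally show ?thesis .
qed

definition ell :: "real \<Rightarrow> real^'p \<Rightarrow> real" where
  "ell lam \<beta> = 1 / (1 + lam) * expectation (\<lambda>\<omega>. ln (q \<beta> (Y \<omega>)))
     + lam / (1 + lam) * expectation (\<lambda>\<omega>. ln (f (Y \<omega> - \<beta> \<bullet> X \<omega>)))"

text \<open>The log term is integrable under the joint density of \<open>(X, Y)\<close>, so the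
  iterated integral, with \<open>x\<close> inside, is by Fubini an expectation.\<close>

lemma ell_pop_eq: "ell_pop \<alpha> d lam \<beta>0 fX \<beta> = ell lam \<beta>"
proof -
  have "(LINT y|lborel. ln (q \<beta> y) * q \<beta>0 y) = expectation (\<lambda>\<omega>. ln (q \<beta> (Y \<omega>)))"
    using q_pos by (subst distributed_integral[OF Y_dens, symmetric]) (auto simp: mult.commute less_imp_le)
  moreover have "(LINT y|lborel. LINT x|lborel. ln (f (y - \<beta> \<bullet> x)) * f (y - \<beta>0 \<bullet> x) * fX x)
      = expectation (\<lambda>\<omega>. ln (f (Y \<omega> - \<beta> \<bullet> X \<omega>)))"
  proof -
    let ?h = "\<lambda>(x, y). f (y - \<beta>0 \<bullet> x) * fX x" and ?g = "\<lambda>(x, y). ln (f (y - \<beta> \<bullet> x))"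
    have D: "distributed M (lborel \<Otimes>\<^sub>M lborel) (\<lambda>\<omega>. (X \<omega>, Y \<omega>)) (\<lambda>p. ennreal (?h p))"
      using joint_X_Y by (simp add: split_beta')
    have nn: "0 \<le> ?h p" for p using f_pos fX_nonneg by (auto simp: split_beta' less_imp_le)
    have "integrable (lborel \<Otimes>\<^sub>M lborel) (\<lambda>p. ?h p * ?g p)"
      using distributed_integrable[OF D, of ?g] nn integrable_ln_f by simp
    then have "integrable (lborel \<Otimes>\<^sub>M lborel) (case_prod (\<lambda>x y. f (y - \<beta>0 \<bullet> x) * fX x * ln (f (y - \<beta> \<bullet> x))))"
      by (simp add: split_beta')
    from lborel_pair.integral_snd[OF this]
    have "(LINT y|lborel. LINT x|lborel. f (y - \<beta>0 \<bullet> x) * fX x * ln (f (y - \<beta> \<bullet> x)))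
      = (LINT p|(lborel \<Otimes>\<^sub>M lborel). ?h p * ?g p)" by (simp add: split_beta')
    also have "\<dots> = expectation (\<lambda>\<omega>. ln (f (Y \<omega> - \<beta> \<bullet> X \<omega>)))"
      using distributed_integral[OF D, of ?g] nn by simp
    finally show ?thesis by (simp add: mult_ac)
  qed
  ultimately show ?thesis
    by (simp add: ell_pop_def ell_def q_eq_lborel dens_Y_eq)
qed

text \<open>Gibbs' inequality for \<open>q \<beta> / q \<beta>0\<close> at \<open>Y\<close>, whose
  mean is the total mass of \<open>q \<beta>\<close>. The inequality cannot be strict in general,
  since different parameters may produce the same mixture.\<close>

lemma expectation_ln_q_le: "expectation (\<lambda>\<omega>. ln (q \<beta> (Y \<omega>))) \<le> expectation (\<lambda>\<omega>. ln (q \<beta>0 (Y \<omega>)))"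
proof -
  have ln: "ln (q \<beta> y / q \<beta>0 y) = ln (q \<beta> y) - ln (q \<beta>0 y)" for y
    using q_pos[of \<beta> y] q_pos[of \<beta>0 y] by (simp add: ln_div)
  have "(\<integral>\<^sup>+\<omega>. ennreal (q \<beta> (Y \<omega>) / q \<beta>0 (Y \<omega>)) \<partial>M)
      = (\<integral>\<^sup>+y. ennreal (q \<beta>0 y) * ennreal (q \<beta> y / q \<beta>0 y) \<partial>lborel)"
    by (rule distributed_nn_integral[OF Y_dens, symmetric]) simp
  also have "\<dots> = (\<integral>\<^sup>+y. ennreal (q \<beta> y) \<partial>lborel)"
    using q_pos by (intro nn_integral_cong) (simp add: less_imp_le less_imp_neq[symmetric] flip: ennreal_mult)
  finally have "(\<integral>\<^sup>+\<omega>. ennreal (q \<beta> (Y \<omega>) / q \<beta>0 (Y \<omega>)) \<partial>M) = 1"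
    by (simp add: nn_integral_q)
  from gibbs_inequality(1)[OF _ _ this] show ?thesis
    using q_pos integrable_ln_q by (simp add: ln)
qed

text \<open>Equality in Gibbs' inequality would make the residuals at \<open>\<beta>\<close> and at
  \<open>\<beta>0\<close> agree in absolute value almost surely, which two null events
  exclude.\<close>

lemma expectation_ln_f_less:
  assumes "\<beta> \<noteq> \<beta>0"
  shows "expectation (\<lambda>\<omega>. ln (f (Y \<omega> - \<beta> \<bullet> X \<omega>))) < expectation (\<lambda>\<omega>. ln (f (Y \<omega> - \<beta>0 \<bullet> X \<omega>)))"
proof -
  let ?W = "\<lambda>\<omega>. f (Y \<omega> - \<beta> \<bullet> X \<omega>) / f (Y \<omega> - \<beta>0 \<bullet> X \<omega>)"
  have ln: "ln (?W \<omega>) = ln (f (Y \<omega> - \<beta> \<bullet> X \<omega>)) - ln (f (Y \<omega> - \<beta>0 \<bullet> X \<omega>))" for \<omega>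
    using f_pos[of "Y \<omega> - \<beta> \<bullet> X \<omega>"] f_pos[of "Y \<omega> - \<beta>0 \<bullet> X \<omega>"] by (simp add: ln_div)
  have pos: "?W \<omega> > 0" for \<omega> using f_pos by simp
  have "(\<integral>\<^sup>+\<omega>. ennreal (?W \<omega>) \<partial>M) = (\<integral>\<^sup>+x. ennreal (fX x) *
      (\<integral>\<^sup>+y. ennreal (f (y - \<beta>0 \<bullet> x)) * ennreal (f (y - \<beta> \<bullet> x) / f (y - \<beta>0 \<bullet> x)) \<partial>lborel) \<partial>lborel)"
    by (subst nn_integral_X_Y[of "\<lambda>(x, y). ennreal (f (y - \<beta> \<bullet> x) / f (y - \<beta>0 \<bullet> x))", simplified]) auto
  also have "\<dots> = (\<integral>\<^sup>+x. ennreal (fX x) * (\<integral>\<^sup>+y. ennreal (f (y - \<beta> \<bullet> x)) \<partial>lborel) \<partial>lborel)"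
    using f_pos by (simp add: less_imp_le less_imp_neq[symmetric] flip: ennreal_mult)
  finally have one: "(\<integral>\<^sup>+\<omega>. ennreal (?W \<omega>) \<partial>M) = 1"
    by (simp add: nn_integral_f_shift nn_integral_fX)
  have int: "integrable M (\<lambda>\<omega>. ln (?W \<omega>))" unfolding ln using integrable_ln_f by simp
  note gibbs = gibbs_inequality[OF _ pos one int]
  have "expectation (\<lambda>\<omega>. ln (?W \<omega>)) \<noteq> 0"
  proof
    assume "expectation (\<lambda>\<omega>. ln (?W \<omega>)) = 0"
    then have "AE \<omega> in M. ?W \<omega> = 1" by (intro gibbs(2)) auto
    moreover have "AE \<omega> in M. (\<beta> - \<beta>0) \<bullet> X \<omega> \<noteq> 0" using assms by (intro inner_X_neq_0) simp
    \<comment> \<open>With \<open>s = (\<beta> - \<beta>0) \<bullet> X\<close>, the equation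
      \<open>\<bar>eps - s\<bar> = \<bar>eps\<bar>\<close> has only the solutions
      \<open>s = 0\<close> and \<open>eps = s / 2\<close>.\<close>
    moreover have "AE \<omega> in M. eps \<omega> \<noteq> (\<beta> - \<beta>0) \<bullet> X \<omega> / 2" by (rule eps_neq) simp
    ultimately have "AE \<omega> in M. False"
    proof eventually_elim
      case (elim \<omega>)
      from elim(1) have "f (Y \<omega> - \<beta> \<bullet> X \<omega>) = f (Y \<omega> - \<beta>0 \<bullet> X \<omega>)"
        by (simp add: divide_simps split: if_splits)
      then have "\<bar>Y \<omega> - \<beta> \<bullet> X \<omega>\<bar> = \<bar>Y \<omega> - \<beta>0 \<bullet> X \<omega>\<bar>"
        unfolding noise_dens_eq_iff[OF alpha d] .
      with elim(2,3) show False by (auto simp: Y_def inner_diff_left abs_eq_iff)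
    qed
    then show False by simp
  qed
  moreover have "expectation (\<lambda>\<omega>. ln (?W \<omega>)) \<le> 0" by (rule gibbs(1)) simp
  ultimately have "expectation (\<lambda>\<omega>. ln (?W \<omega>)) < 0" by simp
  then show ?thesis unfolding ln using integrable_ln_f by simp
qed

lemma ell_less:
  assumes "lam > 0" "\<beta> \<noteq> \<beta>0"
  shows "ell lam \<beta> < ell lam \<beta>0"
  unfolding ell_def using assms expectation_ln_q_le expectation_ln_f_less
  by (intro add_le_less_mono mult_left_mono mult_strict_left_mono) auto

end

section \<open>The sample criterion\<close>

text \<open>The error splits into the two sample errors, carried by bounded weights, and the errors
  of the weights, multiplied by the fixed limits. The criterion and the averages that confine its
  maximizer all have this form.\<close>

lemma (in prob_space) L1_limit_weighted:
  fixes A A' :: "nat \<Rightarrow> 'a \<Rightarrow> real" and n m :: "nat \<Rightarrow> nat"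
  assumes int: "\<And>N. integrable M (A N)" "\<And>N. integrable M (A' N)"
    and A: "(\<lambda>N. expectation (\<lambda>\<omega>. \<bar>A N \<omega> - a\<bar>)) \<longlonglongrightarrow> 0"
    and A': "(\<lambda>N. expectation (\<lambda>\<omega>. \<bar>A' N \<omega> - a'\<bar>)) \<longlonglongrightarrow> 0"
    and n: "filterlim n at_top sequentially" and m: "filterlim m at_top sequentially"
    and ratio: "(\<lambda>k. real (m k) / real (n k)) \<longlonglongrightarrow> lam" and lam: "lam > 0"
  shows "(\<lambda>k. expectation (\<lambda>\<omega>. \<bar>real (n k) / real (n k + m k) * A (n k) \<omega>
      + real (m k) / real (n k + m k) * A' (m k) \<omega> - (1 / (1 + lam) * a + lam / (1 + lam) * a')\<bar>)) \<longlonglongrightarrow> 0"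
proof -
  define v where "v k = real (n k) / real (n k + m k)" for k
  define w where "w k = real (m k) / real (n k + m k)" for k
  have pos: "\<forall>\<^sub>F k in sequentially. n k > 0"
    by (rule eventually_compose_filterlim[OF eventually_gt_at_top n])
  have v: "v \<longlonglongrightarrow> 1 / (1 + lam)"
  proof (rule Lim_transform_eventually)
    show "(\<lambda>k. 1 / (1 + real (m k) / real (n k))) \<longlonglongrightarrow> 1 / (1 + lam)"
      using lam by (intro tendsto_intros ratio) auto
    show "\<forall>\<^sub>F k in sequentially. 1 / (1 + real (m k) / real (n k)) = v k"
      using pos by eventually_elim (simp add: v_def field_simps)
  qed
  have w: "w \<longlonglongrightarrow> lam / (1 + lam)"
  proof (rule Lim_transform_eventually)
    show "(\<lambda>k. (real (m k) / real (n k)) / (1 + real (m k) / real (n k))) \<longlonglongrightarrow> lam / (1 + lam)"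
      using lam by (intro tendsto_intros ratio) auto
    show "\<forall>\<^sub>F k in sequentially. (real (m k) / real (n k)) / (1 + real (m k) / real (n k)) = w k"
      using pos by eventually_elim (simp add: w_def field_simps)
  qed
  let ?E = "\<lambda>k. expectation (\<lambda>\<omega>. \<bar>v k * A (n k) \<omega> + w k * A' (m k) \<omega> - (1 / (1 + lam) * a + lam / (1 + lam) * a')\<bar>)"
  let ?r = "\<lambda>k. v k * expectation (\<lambda>\<omega>. \<bar>A (n k) \<omega> - a\<bar>) + w k * expectation (\<lambda>\<omega>. \<bar>A' (m k) \<omega> - a'\<bar>)
      + (\<bar>v k - 1 / (1 + lam)\<bar> * \<bar>a\<bar> + \<bar>w k - lam / (1 + lam)\<bar> * \<bar>a'\<bar>)"
  have r: "?r \<longlonglongrightarrow> 0"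
    by (rule tendsto_eq_intros v w filterlim_compose[OF A n] filterlim_compose[OF A' m] refl)+ simp
  have tri: "\<bar>p + q + (r + s)\<bar> \<le> \<bar>p\<bar> + \<bar>q\<bar> + (\<bar>r\<bar> + \<bar>s\<bar>)" for p q r s :: real by linarith
  have le: "?E k \<le> ?r k" for k
  proof -
    have vw: "v k \<ge> 0" "w k \<ge> 0" by (auto simp: v_def w_def)
    have "?E k \<le> expectation (\<lambda>\<omega>. v k * \<bar>A (n k) \<omega> - a\<bar> + w k * \<bar>A' (m k) \<omega> - a'\<bar>
      + (\<bar>v k - 1 / (1 + lam)\<bar> * \<bar>a\<bar> + \<bar>w k - lam / (1 + lam)\<bar> * \<bar>a'\<bar>))"
    proof (rule integral_mono)
      fix \<omega>
      have "v k * A (n k) \<omega> + w k * A' (m k) \<omega> - (1 / (1 + lam) * a + lam / (1 + lam) * a')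
        = v k * (A (n k) \<omega> - a) + w k * (A' (m k) \<omega> - a')
          + ((v k - 1 / (1 + lam)) * a + (w k - lam / (1 + lam)) * a')"
        by (simp add: algebra_simps)
      also have "\<bar>\<dots>\<bar> \<le> \<bar>v k * (A (n k) \<omega> - a)\<bar> + \<bar>w k * (A' (m k) \<omega> - a')\<bar>
          + (\<bar>(v k - 1 / (1 + lam)) * a\<bar> + \<bar>(w k - lam / (1 + lam)) * a'\<bar>)" by (rule tri)
      finally show "\<bar>v k * A (n k) \<omega> + w k * A' (m k) \<omega> - (1 / (1 + lam) * a + lam / (1 + lam) * a')\<bar>
        \<le> v k * \<bar>A (n k) \<omega> - a\<bar> + w k * \<bar>A' (m k) \<omega> - a'\<bar>
          + (\<bar>v k - 1 / (1 + lam)\<bar> * \<bar>a\<bar> + \<bar>w k - lam / (1 + lam)\<bar> * \<bar>a'\<bar>)"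
        using vw by (simp add: abs_mult)
    qed (use int in auto)
    also have "\<dots> = ?r k" using int by (simp add: prob_space)
    finally show ?thesis .
  qed
  have "?E \<longlonglongrightarrow> 0"
    by (rule tendsto_sandwich[OF _ _ tendsto_const r]) (use le in auto)
  then show ?thesis unfolding v_def w_def .
qed

lemma abs_ln_diff_le:
  fixes a b l :: real
  assumes "l > 0" "l \<le> a" "l \<le> b"
  shows "\<bar>ln a - ln b\<bar> \<le> \<bar>a - b\<bar> / l"
proof -
  have main: "ln u - ln v \<le> \<bar>u - v\<bar> / l" if "l \<le> u" "l \<le> v" for u v
  proof -
    have "ln u - ln v = ln (u / v)" using that assms by (simp add: ln_div)
    also have "\<dots> \<le> u / v - 1" using that assms by (intro ln_le_minus_one) auto
    also have "\<dots> = (u - v) / v" using that assms by (simp add: field_simps)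
    also have "\<dots> \<le> \<bar>u - v\<bar> / v" using that assms by (intro divide_right_mono) auto
    also have "\<dots> \<le> \<bar>u - v\<bar> / l" using that assms by (intro divide_left_mono) auto
    finally show ?thesis .
  qed
  show ?thesis using main[of a b] main[of b a] assms by (simp add: abs_le_iff abs_minus_commute)
qed

text \<open>All observations form one family over a sum of three copies of \<open>nat\<close>,
  padded with zeros to a common type. Its independence yields at once independence within each
  sample and between the samples; a matched pair is a single member, so its two entries may depend
  on each other.\<close>

locale matched_unmatched_samples = regression_model M X eps Y fX \<beta>0 \<alpha> d B
  for M :: "'a measure" and X :: "'a \<Rightarrow> real^'p" and eps Y fX \<beta>0 \<alpha> d B +
  fixes Xt Xs :: "nat \<Rightarrow> 'a \<Rightarrow> real^'p" and Yt Ys :: "nat \<Rightarrow> 'a \<Rightarrow> real"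
    and n m :: "nat \<Rightarrow> nat" and lam :: real
  assumes Xt_meas[measurable]: "\<And>i. Xt i \<in> borel_measurable M"
    and Yt_meas[measurable]: "\<And>j. Yt j \<in> borel_measurable M"
    and Xs_meas[measurable]: "\<And>k. Xs k \<in> borel_measurable M"
    and Ys_meas[measurable]: "\<And>k. Ys k \<in> borel_measurable M"
    and Xt_law: "\<And>i. distr M borel (Xt i) = distr M borel X"
    and Yt_law: "\<And>j. distr M borel (Yt j) = distr M borel Y"
    and XYs_law: "\<And>k. distr M borel (\<lambda>\<omega>. (Xs k \<omega>, Ys k \<omega>)) = distr M borel (\<lambda>\<omega>. (X \<omega>, Y \<omega>))"
    and samples_indep: "indep_vars (\<lambda>_. borel)
        (\<lambda>s \<omega>. case s of Inl i \<Rightarrow> (Xt i \<omega>, 0::real)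
                      | Inr (Inl j) \<Rightarrow> (0, Yt j \<omega>)
                      | Inr (Inr k) \<Rightarrow> (Xs k \<omega>, Ys k \<omega>)) UNIV"
    and n_lim: "filterlim n at_top sequentially"
    and m_lim: "filterlim m at_top sequentially"
    and ratio: "(\<lambda>k. real (m k) / real (n k)) \<longlonglongrightarrow> lam"
    and lam: "0 < lam" "lam < 1"
begin

section \<open>Transfer of the population laws to the samples\<close>

lemma equal_law:
  fixes g :: "'c::topological_space \<Rightarrow> real"
  assumes law: "distr M borel U = distr M borel Z"
    and [measurable]: "U \<in> borel_measurable M" "Z \<in> borel_measurable M" "g \<in> borel_measurable borel"
  shows expectation_cong_law: "expectation (\<lambda>\<omega>. g (U \<omega>)) = expectation (\<lambda>\<omega>. g (Z \<omega>))"
    and integrable_cong_law: "integrable M (\<lambda>\<omega>. g (U \<omega>)) \<longleftrightarrow> integrable M (\<lambda>\<omega>. g (Z \<omega>))"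
    and AE_cong_law: "(AE \<omega> in M. g (U \<omega>) \<le> r) \<longleftrightarrow> (AE \<omega> in M. g (Z \<omega>) \<le> r)"
proof -
  show "expectation (\<lambda>\<omega>. g (U \<omega>)) = expectation (\<lambda>\<omega>. g (Z \<omega>))"
    using law by (simp flip: integral_distr[of _ M borel])
  show "integrable M (\<lambda>\<omega>. g (U \<omega>)) \<longleftrightarrow> integrable M (\<lambda>\<omega>. g (Z \<omega>))"
    using law by (simp flip: integrable_distr_eq[of _ M borel])
  have U: "(AE x in distr M borel U. g x \<le> r) \<longleftrightarrow> (AE \<omega> in M. g (U \<omega>) \<le> r)"
    by (subst AE_distr_iff; simp)
  have Z: "(AE x in distr M borel Z. g x \<le> r) \<longleftrightarrow> (AE \<omega> in M. g (Z \<omega>) \<le> r)"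
    by (subst AE_distr_iff; simp)
  show "(AE \<omega> in M. g (U \<omega>) \<le> r) \<longleftrightarrow> (AE \<omega> in M. g (Z \<omega>) \<le> r)"
    by (rule trans[OF sym[OF U[unfolded law]] Z])
qed

lemma borel_measurable_pair[measurable]:
  "U \<in> borel_measurable M \<Longrightarrow> Z \<in> borel_measurable M \<Longrightarrow> (\<lambda>\<omega>. (U \<omega> :: real^'p, Z \<omega> :: real)) \<in> borel_measurable M"
  by (simp add: borel_prod[symmetric])

lemmas Xt_expectation = expectation_cong_law[OF Xt_law Xt_meas X_measurable]
  and Xt_integrable = integrable_cong_law[OF Xt_law Xt_meas X_measurable]
  and Yt_expectation = expectation_cong_law[OF Yt_law Yt_meas Y_measurable]
  and Yt_integrable = integrable_cong_law[OF Yt_law Yt_meas Y_measurable]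

lemma
  fixes g :: "real^'p \<Rightarrow> real \<Rightarrow> real"
  assumes [measurable]: "(\<lambda>(x, y). g x y) \<in> borel_measurable (borel \<Otimes>\<^sub>M borel)"
  shows matched_expectation: "expectation (\<lambda>\<omega>. g (Xs k \<omega>) (Ys k \<omega>)) = expectation (\<lambda>\<omega>. g (X \<omega>) (Y \<omega>))"
    and matched_integrable: "integrable M (\<lambda>\<omega>. g (Xs k \<omega>) (Ys k \<omega>)) \<longleftrightarrow> integrable M (\<lambda>\<omega>. g (X \<omega>) (Y \<omega>))"
    and matched_AE: "(AE \<omega> in M. g (Xs k \<omega>) (Ys k \<omega>) \<le> r) \<longleftrightarrow> (AE \<omega> in M. g (X \<omega>) (Y \<omega>) \<le> r)"
proof -
  have g: "(\<lambda>(x, y). g x y) \<in> borel_measurable borel" using assms by (simp add: borel_prod)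
  note * = XYs_law[of k] _ _ g
  show "expectation (\<lambda>\<omega>. g (Xs k \<omega>) (Ys k \<omega>)) = expectation (\<lambda>\<omega>. g (X \<omega>) (Y \<omega>))"
    using expectation_cong_law[OF *] by simp
  show "integrable M (\<lambda>\<omega>. g (Xs k \<omega>) (Ys k \<omega>)) \<longleftrightarrow> integrable M (\<lambda>\<omega>. g (X \<omega>) (Y \<omega>))"
    using integrable_cong_law[OF *] by simp
  show "(AE \<omega> in M. g (Xs k \<omega>) (Ys k \<omega>) \<le> r) \<longleftrightarrow> (AE \<omega> in M. g (X \<omega>) (Y \<omega>) \<le> r)"
    using AE_cong_law[OF *] by simp
qed

lemma Xt_bdd: "AE \<omega> in M. \<forall>i. norm (Xt i \<omega>) \<le> B"
  unfolding AE_all_countable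
  using X_bdd AE_cong_law[OF Xt_law Xt_meas X_measurable, of norm] by simp

lemma Xs_bdd: "AE \<omega> in M. \<forall>k. norm (Xs k \<omega>) \<le> B"
  unfolding AE_all_countable using X_bdd matched_AE[of "\<lambda>x y. norm x"] by simp

lemma fst_snd_borel[measurable]:
  "fst \<in> borel_measurable (borel :: ((real^'p) \<times> real) measure)"
  "snd \<in> borel_measurable (borel :: ((real^'p) \<times> real) measure)"
  by (intro borel_measurable_continuous_onI continuous_intros)+

text \<open>Kept at fixed \<open>N\<close> with its rate: applied to
  \<open>x \<mapsto> f (y - \<beta> \<bullet> x)\<close> with \<open>v = c\<^sup>2\<close>, it gives
  a bound that does not depend on \<open>y\<close>.\<close>

lemma Xt_weak_law:
  assumes [measurable]: "g \<in> borel_measurable borel" and int: "integrable M (\<lambda>\<omega>. (g (X \<omega>))\<^sup>2)"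
    and v: "expectation (\<lambda>\<omega>. (g (X \<omega>))\<^sup>2) \<le> v" and N: "N > 0"
  shows "expectation (\<lambda>\<omega>. \<bar>(\<Sum>i<N. g (Xt i \<omega>)) / real N - expectation (\<lambda>\<omega>. g (X \<omega>))\<bar>) \<le> sqrt (v / real N)"
  using weak_law_L1[OF samples_indep, of Inl "\<lambda>p. g (fst p)", OF _ _ _ _ _ N] int v
  by (auto simp: Xt_expectation[of g] Xt_expectation[of "\<lambda>x. (g x)\<^sup>2"] Xt_integrable[of "\<lambda>x. (g x)\<^sup>2"])

lemma sqrt_over_tendsto_0: "(\<lambda>N. sqrt (v / real N)) \<longlonglongrightarrow> 0"
  using tendsto_real_sqrt[OF lim_const_over_n[of v]] by simp

lemma Yt_weak_law:
  assumes [measurable]: "g \<in> borel_measurable borel" and int: "integrable M (\<lambda>\<omega>. (g (Y \<omega>))\<^sup>2)"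
  shows "(\<lambda>N. expectation (\<lambda>\<omega>. \<bar>(\<Sum>j<N. g (Yt j \<omega>)) / real N - expectation (\<lambda>\<omega>. g (Y \<omega>))\<bar>)) \<longlonglongrightarrow> 0"
proof (rule tendsto_sandwich[OF _ _ tendsto_const sqrt_over_tendsto_0])
  show "\<forall>\<^sub>F N in sequentially. expectation (\<lambda>\<omega>. \<bar>(\<Sum>j<N. g (Yt j \<omega>)) / real N - expectation (\<lambda>\<omega>. g (Y \<omega>))\<bar>)
      \<le> sqrt (expectation (\<lambda>\<omega>. (g (Y \<omega>))\<^sup>2) / real N)"
    using eventually_gt_at_top[of 0]
  proof eventually_elim
    case (elim N)
    show ?case
      using weak_law_L1[OF samples_indep, of "\<lambda>j. Inr (Inl j)" "\<lambda>p. g (snd p)", OF _ _ _ _ _ elim] int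
      by (auto simp: Yt_expectation[of g] Yt_expectation[of "\<lambda>x. (g x)\<^sup>2"] Yt_integrable[of "\<lambda>x. (g x)\<^sup>2"]
          inj_def)
  qed
qed auto

lemma matched_weak_law:
  fixes g :: "real^'p \<Rightarrow> real \<Rightarrow> real"
  assumes g[measurable]: "(\<lambda>(x, y). g x y) \<in> borel_measurable (borel \<Otimes>\<^sub>M borel)"
    and int: "integrable M (\<lambda>\<omega>. (g (X \<omega>) (Y \<omega>))\<^sup>2)"
  shows "(\<lambda>N. expectation (\<lambda>\<omega>. \<bar>(\<Sum>k<N. g (Xs k \<omega>) (Ys k \<omega>)) / real N - expectation (\<lambda>\<omega>. g (X \<omega>) (Y \<omega>))\<bar>)) \<longlonglongrightarrow> 0"
proof (rule tendsto_sandwich[OF _ _ tendsto_const sqrt_over_tendsto_0])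
  have [measurable]: "(\<lambda>(x, y). g x y) \<in> borel_measurable borel" using g by (simp add: borel_prod)
  show "\<forall>\<^sub>F N in sequentially. expectation (\<lambda>\<omega>. \<bar>(\<Sum>k<N. g (Xs k \<omega>) (Ys k \<omega>)) / real N - expectation (\<lambda>\<omega>. g (X \<omega>) (Y \<omega>))\<bar>)
      \<le> sqrt (expectation (\<lambda>\<omega>. (g (X \<omega>) (Y \<omega>))\<^sup>2) / real N)"
    using eventually_gt_at_top[of 0]
  proof eventually_elim
    case (elim N)
    show ?case
      using weak_law_L1[OF samples_indep, of "\<lambda>k. Inr (Inr k)" "\<lambda>(x, y). g x y", OF _ _ _ _ _ elim] int
      by (auto simp: matched_expectation[of g] matched_expectation[of "\<lambda>x y. (g x y)\<^sup>2"] matched_integrable[of "\<lambda>x y. (g x y)\<^sup>2"]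
          inj_def)
  qed
qed auto

text \<open>Decouples one response from the entire covariate sequence. The index set is split into
  the block of all \<open>Xt\<close> and the single index of \<open>Yt j\<close>; the restrictions
  to disjoint blocks are independent, and Tonelli applies to the product of their laws.\<close>

lemma nn_integral_Xt_Yt:
  fixes h :: "(nat \<Rightarrow> real^'p) \<times> real \<Rightarrow> ennreal"
  assumes h[measurable]: "h \<in> borel_measurable (PiM UNIV (\<lambda>_. borel) \<Otimes>\<^sub>M borel)"
  shows "(\<integral>\<^sup>+\<omega>. h (\<lambda>i. Xt i \<omega>, Yt j \<omega>) \<partial>M) = (\<integral>\<^sup>+\<omega>'. (\<integral>\<^sup>+\<omega>. h (\<lambda>i. Xt i \<omega>, Yt j \<omega>') \<partial>M) \<partial>M)"
proof -
  let ?W = "\<lambda>s \<omega>. case s of Inl i \<Rightarrow> (Xt i \<omega>, 0::real)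
                      | Inr (Inl j) \<Rightarrow> (0, Yt j \<omega>)
                      | Inr (Inr k) \<Rightarrow> (Xs k \<omega>, Ys k \<omega>)"
  let ?A = "range Inl :: (nat + nat + nat) set" and ?B = "{Inr (Inl j)} :: (nat + nat + nat) set"
  let ?PA = "PiM ?A (\<lambda>_. borel :: ((real^'p) \<times> real) measure)"
  let ?PB = "PiM ?B (\<lambda>_. borel :: ((real^'p) \<times> real) measure)"
  let ?U = "\<lambda>\<omega>. restrict (\<lambda>s. ?W s \<omega>) ?A" and ?Z = "\<lambda>\<omega>. restrict (\<lambda>s. ?W s \<omega>) ?B"
  \<comment> \<open>Forgets the zero padding of both blocks.\<close>
  let ?T = "\<lambda>p. (\<lambda>i. fst (fst p (Inl i)), snd (snd p (Inr (Inl j))))"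
  have ind: "indep_var ?PA ?U ?PB ?Z"
    by (rule indep_var_restrict[OF samples_indep]) auto
  then have U[measurable]: "?U \<in> measurable M ?PA" and Z[measurable]: "?Z \<in> measurable M ?PB"
    and law: "distr M ?PA ?U \<Otimes>\<^sub>M distr M ?PB ?Z = distr M (?PA \<Otimes>\<^sub>M ?PB) (\<lambda>\<omega>. (?U \<omega>, ?Z \<omega>))"
    unfolding indep_var_distribution_eq by auto
  have T[measurable]: "?T \<in> measurable (?PA \<Otimes>\<^sub>M ?PB) (PiM UNIV (\<lambda>_. borel) \<Otimes>\<^sub>M borel)"
  proof (intro measurable_Pair)
    show "(\<lambda>p i. fst (fst p (Inl i))) \<in> measurable (?PA \<Otimes>\<^sub>M ?PB) (PiM UNIV (\<lambda>_. borel))"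
    proof (rule measurable_PiM_single')
      fix i :: nat
      have [measurable]: "(\<lambda>u. u (Inl i)) \<in> measurable ?PA borel" by (rule measurable_component_singleton) simp
      show "(\<lambda>p. fst (fst p (Inl i))) \<in> borel_measurable (?PA \<Otimes>\<^sub>M ?PB)" by measurable
    qed simp
    have [measurable]: "(\<lambda>u. u (Inr (Inl j))) \<in> measurable ?PB borel" by (rule measurable_component_singleton) simp
    show "(\<lambda>p. snd (snd p (Inr (Inl j)))) \<in> borel_measurable (?PA \<Otimes>\<^sub>M ?PB)" by measurable
  qed
  interpret PA: prob_space "distr M ?PA ?U" by (rule prob_space_distr) measurable
  interpret PB: prob_space "distr M ?PB ?Z" by (rule prob_space_distr) measurable
  interpret P: pair_sigma_finite "distr M ?PA ?U" "distr M ?PB ?Z" ..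
  have hT: "(\<lambda>p. h (?T p)) \<in> borel_measurable (distr M ?PA ?U \<Otimes>\<^sub>M distr M ?PB ?Z)"
    using measurable_compose[OF T h] by (simp cong: measurable_cong_sets sets_pair_measure_cong)
  have "(\<integral>\<^sup>+\<omega>. h (\<lambda>i. Xt i \<omega>, Yt j \<omega>) \<partial>M) = (\<integral>\<^sup>+\<omega>. h (?T (?U \<omega>, ?Z \<omega>)) \<partial>M)" by simp
  also have "\<dots> = (\<integral>\<^sup>+p. h (?T p) \<partial>distr M (?PA \<Otimes>\<^sub>M ?PB) (\<lambda>\<omega>. (?U \<omega>, ?Z \<omega>)))"
    by (rule nn_integral_distr[symmetric]) measurable
  also have "\<dots> = (\<integral>\<^sup>+p. h (?T p) \<partial>(distr M ?PA ?U \<Otimes>\<^sub>M distr M ?PB ?Z))" by (simp only: law)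
  also have "\<dots> = (\<integral>\<^sup>+z. (\<integral>\<^sup>+u. h (?T (u, z)) \<partial>distr M ?PA ?U) \<partial>distr M ?PB ?Z)"
    by (rule P.nn_integral_snd[symmetric, OF hT])
  also have "\<dots> = (\<integral>\<^sup>+z. (\<integral>\<^sup>+\<omega>. h (?T (?U \<omega>, z)) \<partial>M) \<partial>distr M ?PB ?Z)"
  proof (rule nn_integral_cong)
    fix z assume "z \<in> space (distr M ?PB ?Z)"
    then have "(\<lambda>u. (u, z)) \<in> measurable ?PA (?PA \<Otimes>\<^sub>M ?PB)" by (intro measurable_Pair2') simp
    from measurable_compose[OF measurable_compose[OF this T] h]
    show "(\<integral>\<^sup>+u. h (?T (u, z)) \<partial>distr M ?PA ?U) = (\<integral>\<^sup>+\<omega>. h (?T (?U \<omega>, z)) \<partial>M)"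
      by (subst nn_integral_distr[OF U]) simp_all
  qed
  also have "\<dots> = (\<integral>\<^sup>+\<omega>'. (\<integral>\<^sup>+\<omega>. h (?T (?U \<omega>, ?Z \<omega>')) \<partial>M) \<partial>M)"
    by (rule nn_integral_distr[OF Z]) measurable
  also have "\<dots> = (\<integral>\<^sup>+\<omega>'. (\<integral>\<^sup>+\<omega>. h (\<lambda>i. Xt i \<omega>, Yt j \<omega>') \<partial>M) \<partial>M)" by simp
  finally show ?thesis .
qed

section \<open>The empirical mixture against its limit\<close>

definition mix :: "nat \<Rightarrow> real^'p \<Rightarrow> (nat \<Rightarrow> real^'p) \<Rightarrow> real \<Rightarrow> real" where
  "mix N \<beta> x y = ln ((\<Sum>i<N. f (y - \<beta> \<bullet> x i)) / real N)"

text \<open>A minimum of two bounds: the second tends to 0 at each \<open>y\<close>, but its factor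
  \<open>1 / lower\<close> grows exponentially in \<open>V\<close>; the first does not shrink, but
  is integrable and independent of \<open>N\<close>. Together they satisfy the hypotheses of
  dominated convergence.\<close>

definition mix_error :: "nat \<Rightarrow> real^'p \<Rightarrow> real \<Rightarrow> real" where
  "mix_error N \<beta> y = min (2 * (\<bar>ln c\<bar> + d powr (- \<alpha>) * V (norm \<beta>) y)) (sqrt (c\<^sup>2 / real N) / lower (norm \<beta>) y)"

lemma avg_f_bounds:
  assumes "N > 0" "\<And>i. norm (x i) \<le> B" "norm \<beta> \<le> R"
  shows "lower R y \<le> (\<Sum>i<N. f (y - \<beta> \<bullet> x i)) / real N" "(\<Sum>i<N. f (y - \<beta> \<bullet> x i)) / real N \<le> c"
  using sum_bounded_below[of "{..<N}" "lower R y" "\<lambda>i. f (y - \<beta> \<bullet> x i)"]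
    sum_bounded_above[of "{..<N}" "\<lambda>i. f (y - \<beta> \<bullet> x i)" c] f_lower[OF assms(3,2)] f_le assms(1)
  by (auto simp: field_simps)

lemma mix_dominated:
  assumes "N > 0" "\<And>i. norm (x i) \<le> B"
  shows "\<bar>mix N \<beta> x y\<bar> \<le> \<bar>ln c\<bar> + d powr (- \<alpha>) * V (norm \<beta>) y"
  unfolding mix_def by (intro abs_ln_le avg_f_bounds[OF assms order_refl])

lemma mix_measurable[measurable]:
  assumes [measurable]: "\<And>i. x i \<in> borel_measurable N'" "y \<in> borel_measurable N'"
  shows "(\<lambda>\<omega>. mix N \<beta> (\<lambda>i. x i \<omega>) (y \<omega>)) \<in> borel_measurable N'"
  unfolding mix_def by measurable

lemma mix_error_measurable[measurable]: "mix_error N \<beta> \<in> borel_measurable borel"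
  unfolding mix_error_def[abs_def] lower_def by measurable

lemma mix_error_nonneg: "0 \<le> mix_error N \<beta> y"
  using lower_pos by (auto simp: mix_error_def less_imp_le)

lemma mix_error_le: "mix_error N \<beta> y \<le> 2 * (\<bar>ln c\<bar> + d powr (- \<alpha>) * V (norm \<beta>) y)"
  by (simp add: mix_error_def)

lemma integrable_mix_error: "integrable M (\<lambda>\<omega>. mix_error N \<beta> (Y \<omega>))"
proof (rule Bochner_Integration.integrable_bound)
  show "integrable M (\<lambda>\<omega>. 2 * (\<bar>ln c\<bar> + d powr (- \<alpha>) * V (norm \<beta>) (Y \<omega>)))"
    using integrable_V[of "norm \<beta>"] by simp
  show "AE \<omega> in M. norm (mix_error N \<beta> (Y \<omega>)) \<le> norm (2 * (\<bar>ln c\<bar> + d powr (- \<alpha>) * V (norm \<beta>) (Y \<omega>)))"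
    using mix_error_nonneg mix_error_le by (intro AE_I2) (auto intro: order_trans)
qed measurable

lemma mix_error_tendsto: "(\<lambda>N. expectation (\<lambda>\<omega>. mix_error N \<beta> (Y \<omega>))) \<longlonglongrightarrow> 0"
proof -
  have "(\<lambda>N. expectation (\<lambda>\<omega>. mix_error N \<beta> (Y \<omega>))) \<longlonglongrightarrow> expectation (\<lambda>\<omega>. 0)"
  proof (rule integral_dominated_convergence)
    show "integrable M (\<lambda>\<omega>. 2 * (\<bar>ln c\<bar> + d powr (- \<alpha>) * V (norm \<beta>) (Y \<omega>)))"
      using integrable_V[of "norm \<beta>"] by simp
    show "AE \<omega> in M. norm (mix_error N \<beta> (Y \<omega>)) \<le> 2 * (\<bar>ln c\<bar> + d powr (- \<alpha>) * V (norm \<beta>) (Y \<omega>))" for N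
      using mix_error_nonneg mix_error_le by (intro AE_I2) auto
    have "(\<lambda>N. mix_error N \<beta> y) \<longlonglongrightarrow> 0" for y
    proof (rule tendsto_sandwich[OF _ _ tendsto_const])
      show "(\<lambda>N. sqrt (c\<^sup>2 / real N) / lower (norm \<beta>) y) \<longlonglongrightarrow> 0"
        using tendsto_divide[OF sqrt_over_tendsto_0[of "c\<^sup>2"] tendsto_const] lower_pos[of "norm \<beta>" y] by force
    qed (use mix_error_nonneg in \<open>auto simp: mix_error_def\<close>)
    then show "AE \<omega> in M. (\<lambda>N. mix_error N \<beta> (Y \<omega>)) \<longlonglongrightarrow> 0" by simp
  qed measurable
  then show ?thesis by simp
qed

text \<open>At fixed \<open>y\<close> both the empirical and the true mixture lie above
  \<open>lower\<close>, where the logarithm has slope at most \<open>1 / lower\<close>. The weak law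
  then bounds their distance, and the envelope bounds the rest.\<close>

lemma mix_ln_q_at:
  assumes N: "N > 0"
  shows "(\<integral>\<^sup>+\<omega>. ennreal \<bar>mix N \<beta> (\<lambda>i. Xt i \<omega>) y - ln (q \<beta> y)\<bar> \<partial>M) \<le> ennreal (mix_error N \<beta> y)"
proof -
  let ?avg = "\<lambda>\<omega>. (\<Sum>i<N. f (y - \<beta> \<bullet> Xt i \<omega>)) / real N"
  have dom: "AE \<omega> in M. \<bar>mix N \<beta> (\<lambda>i. Xt i \<omega>) y - ln (q \<beta> y)\<bar> \<le> 2 * (\<bar>ln c\<bar> + d powr (- \<alpha>) * V (norm \<beta>) y)"
    using Xt_bdd
  proof eventually_elim
    case (elim \<omega>)
    then have "\<bar>mix N \<beta> (\<lambda>i. Xt i \<omega>) y\<bar> \<le> \<bar>ln c\<bar> + d powr (- \<alpha>) * V (norm \<beta>) y"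
      using N by (intro mix_dominated) auto
    with ln_q_dominated[of \<beta> "norm \<beta>" y] show ?case by simp
  qed
  have int: "integrable M (\<lambda>\<omega>. \<bar>mix N \<beta> (\<lambda>i. Xt i \<omega>) y - ln (q \<beta> y)\<bar>)"
    using dom by (intro integrable_const_bound) auto
  have "(\<integral>\<^sup>+\<omega>. ennreal \<bar>mix N \<beta> (\<lambda>i. Xt i \<omega>) y - ln (q \<beta> y)\<bar> \<partial>M)
      = ennreal (expectation (\<lambda>\<omega>. \<bar>mix N \<beta> (\<lambda>i. Xt i \<omega>) y - ln (q \<beta> y)\<bar>))"
    using int by (intro nn_integral_eq_integral) auto
  also have "\<dots> \<le> ennreal (mix_error N \<beta> y)"
  proof (rule ennreal_leI)
    have "expectation (\<lambda>\<omega>. \<bar>mix N \<beta> (\<lambda>i. Xt i \<omega>) y - ln (q \<beta> y)\<bar>) \<le> 2 * (\<bar>ln c\<bar> + d powr (- \<alpha>) * V (norm \<beta>) y)"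
      using int dom by (intro integral_le_const)
    moreover have "expectation (\<lambda>\<omega>. \<bar>mix N \<beta> (\<lambda>i. Xt i \<omega>) y - ln (q \<beta> y)\<bar>) \<le> sqrt (c\<^sup>2 / real N) / lower (norm \<beta>) y"
    proof -
      have "integrable M ?avg"
        using Xt_integrable[of "\<lambda>x. f (y - \<beta> \<bullet> x)"] by simp
      then have iavg: "integrable M (\<lambda>\<omega>. \<bar>?avg \<omega> - q \<beta> y\<bar> / lower (norm \<beta>) y)" by simp
      have "expectation (\<lambda>\<omega>. \<bar>mix N \<beta> (\<lambda>i. Xt i \<omega>) y - ln (q \<beta> y)\<bar>)
          \<le> expectation (\<lambda>\<omega>. \<bar>?avg \<omega> - q \<beta> y\<bar> / lower (norm \<beta>) y)"
      proof (rule integral_mono_AE[OF int iavg])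
        show "AE \<omega> in M. \<bar>mix N \<beta> (\<lambda>i. Xt i \<omega>) y - ln (q \<beta> y)\<bar> \<le> \<bar>?avg \<omega> - q \<beta> y\<bar> / lower (norm \<beta>) y"
          using Xt_bdd unfolding mix_def
          by eventually_elim (intro abs_ln_diff_le lower_pos avg_f_bounds q_ge N order_refl; blast)
      qed
      also have "\<dots> = expectation (\<lambda>\<omega>. \<bar>?avg \<omega> - q \<beta> y\<bar>) / lower (norm \<beta>) y" by simp
      also have "\<dots> \<le> sqrt (c\<^sup>2 / real N) / lower (norm \<beta>) y"
      proof (intro divide_right_mono)
        have sq: "(f t)\<^sup>2 \<le> c\<^sup>2" for t using f_pos[of t] f_le[of t] by (intro power_mono) auto
        have i2: "integrable M (\<lambda>\<omega>. (f (y - \<beta> \<bullet> X \<omega>))\<^sup>2)"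
          using sq by (intro integrable_const_bound[where B="c\<^sup>2"]) auto
        moreover from this have "expectation (\<lambda>\<omega>. (f (y - \<beta> \<bullet> X \<omega>))\<^sup>2) \<le> c\<^sup>2"
          using sq by (intro integral_le_const) auto
        ultimately show "expectation (\<lambda>\<omega>. \<bar>?avg \<omega> - q \<beta> y\<bar>) \<le> sqrt (c\<^sup>2 / real N)"
          unfolding q_def using N by (intro Xt_weak_law) auto
      qed (simp add: lower_pos less_imp_le)
      finally show ?thesis .
    qed
    ultimately show "expectation (\<lambda>\<omega>. \<bar>mix N \<beta> (\<lambda>i. Xt i \<omega>) y - ln (q \<beta> y)\<bar>) \<le> mix_error N \<beta> y"
      by (simp add: mix_error_def)
  qed
  finally show ?thesis .
qed

lemma integrable_mix: "integrable M (\<lambda>\<omega>. mix N \<beta> (\<lambda>i. Xt i \<omega>) (Yt j \<omega>))"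
proof (cases "N > 0")
  case True
  show ?thesis
  proof (rule Bochner_Integration.integrable_bound)
    show "integrable M (\<lambda>\<omega>. \<bar>ln c\<bar> + d powr (- \<alpha>) * V (norm \<beta>) (Yt j \<omega>))"
      using Yt_integrable[of "V (norm \<beta>)"] integrable_V[of "norm \<beta>"] by simp
    show "AE \<omega> in M. norm (mix N \<beta> (\<lambda>i. Xt i \<omega>) (Yt j \<omega>)) \<le> norm (\<bar>ln c\<bar> + d powr (- \<alpha>) * V (norm \<beta>) (Yt j \<omega>))"
      using Xt_bdd
    proof eventually_elim
      case (elim \<omega>)
      then have "\<bar>mix N \<beta> (\<lambda>i. Xt i \<omega>) (Yt j \<omega>)\<bar> \<le> \<bar>ln c\<bar> + d powr (- \<alpha>) * V (norm \<beta>) (Yt j \<omega>)"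
        using True by (intro mix_dominated) auto
      then show ?case by simp
    qed
  qed measurable
\<comment> \<open>Over an empty sample the mixture term is a constant.\<close>
qed (simp add: mix_def)

text \<open>By independence the response can be held fixed while the covariates are averaged, so the
  bound at fixed \<open>y\<close> is integrated against the law of \<open>Y\<close>.\<close>

lemma mix_ln_q_Yt:
  assumes N: "N > 0"
  shows "expectation (\<lambda>\<omega>. \<bar>mix N \<beta> (\<lambda>i. Xt i \<omega>) (Yt j \<omega>) - ln (q \<beta> (Yt j \<omega>))\<bar>)
    \<le> expectation (\<lambda>\<omega>. mix_error N \<beta> (Y \<omega>))"
proof -
  have iq: "integrable M (\<lambda>\<omega>. ln (q \<beta> (Yt j \<omega>)))"
    using Yt_integrable[of "\<lambda>y. ln (q \<beta> y)"] integrable_ln_q by simp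
  have ie: "integrable M (\<lambda>\<omega>. mix_error N \<beta> (Yt j \<omega>))"
    using Yt_integrable[of "mix_error N \<beta>"] integrable_mix_error by simp
  let ?h = "\<lambda>(x, y). ennreal \<bar>mix N \<beta> x y - ln (q \<beta> y)\<bar>"
  have h: "?h \<in> borel_measurable (PiM UNIV (\<lambda>_. borel) \<Otimes>\<^sub>M borel)"
    unfolding mix_def by measurable
  have "ennreal (expectation (\<lambda>\<omega>. \<bar>mix N \<beta> (\<lambda>i. Xt i \<omega>) (Yt j \<omega>) - ln (q \<beta> (Yt j \<omega>))\<bar>))
      = (\<integral>\<^sup>+\<omega>. ennreal \<bar>mix N \<beta> (\<lambda>i. Xt i \<omega>) (Yt j \<omega>) - ln (q \<beta> (Yt j \<omega>))\<bar> \<partial>M)"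
    using iq integrable_mix by (intro nn_integral_eq_integral[symmetric]) auto
  also have "\<dots> = (\<integral>\<^sup>+\<omega>'. (\<integral>\<^sup>+\<omega>. ennreal \<bar>mix N \<beta> (\<lambda>i. Xt i \<omega>) (Yt j \<omega>') - ln (q \<beta> (Yt j \<omega>'))\<bar> \<partial>M) \<partial>M)"
    using nn_integral_Xt_Yt[OF h] by simp
  also have "\<dots> \<le> (\<integral>\<^sup>+\<omega>'. ennreal (mix_error N \<beta> (Yt j \<omega>')) \<partial>M)"
    by (intro nn_integral_mono mix_ln_q_at N)
  also have "\<dots> = ennreal (expectation (\<lambda>\<omega>. mix_error N \<beta> (Yt j \<omega>)))"
    using ie mix_error_nonneg by (intro nn_integral_eq_integral) auto
  also have "\<dots> = ennreal (expectation (\<lambda>\<omega>. mix_error N \<beta> (Y \<omega>)))"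
    by (simp add: Yt_expectation)
  finally show ?thesis
    using mix_error_nonneg by (subst (asm) ennreal_le_iff) (auto intro!: Bochner_Integration.integral_nonneg)
qed

text \<open>Replacing each mixture term by \<open>ln (q \<beta>)\<close> costs the same mean error
  for every \<open>j\<close>, and linearity of expectation adds these costs without regard to the
  dependence between terms. What is left is an i.i.d. average.\<close>

lemma mix_avg_tendsto:
  "(\<lambda>N. expectation (\<lambda>\<omega>. \<bar>(\<Sum>j<N. mix N \<beta> (\<lambda>i. Xt i \<omega>) (Yt j \<omega>)) / real N
      - expectation (\<lambda>\<omega>. ln (q \<beta> (Y \<omega>)))\<bar>)) \<longlonglongrightarrow> 0"
proof (rule tendsto_sandwich[OF _ _ tendsto_const])
  let ?\<mu> = "expectation (\<lambda>\<omega>. ln (q \<beta> (Y \<omega>)))"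
  let ?r = "\<lambda>N. expectation (\<lambda>\<omega>. mix_error N \<beta> (Y \<omega>))
      + expectation (\<lambda>\<omega>. \<bar>(\<Sum>j<N. ln (q \<beta> (Yt j \<omega>))) / real N - ?\<mu>\<bar>)"
  have "?r \<longlonglongrightarrow> 0 + 0"
    by (intro tendsto_add mix_error_tendsto Yt_weak_law integrable_ln_q_square) measurable
  then show "?r \<longlonglongrightarrow> 0" by simp
  have iq: "integrable M (\<lambda>\<omega>. ln (q \<beta> (Yt j \<omega>)))" for j
    using Yt_integrable[of "\<lambda>y. ln (q \<beta> y)"] integrable_ln_q by simp
  show "\<forall>\<^sub>F N in sequentially. expectation (\<lambda>\<omega>. \<bar>(\<Sum>j<N. mix N \<beta> (\<lambda>i. Xt i \<omega>) (Yt j \<omega>)) / real N - ?\<mu>\<bar>) \<le> ?r N"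
    using eventually_gt_at_top[of 0]
  proof eventually_elim
    case (elim N)
    let ?m = "\<lambda>j \<omega>. mix N \<beta> (\<lambda>i. Xt i \<omega>) (Yt j \<omega>)" and ?q = "\<lambda>j \<omega>. ln (q \<beta> (Yt j \<omega>))"
    have "expectation (\<lambda>\<omega>. \<bar>(\<Sum>j<N. ?m j \<omega>) / real N - ?\<mu>\<bar>)
        \<le> expectation (\<lambda>\<omega>. (\<Sum>j<N. \<bar>?m j \<omega> - ?q j \<omega>\<bar>) / real N + \<bar>(\<Sum>j<N. ?q j \<omega>) / real N - ?\<mu>\<bar>)"
    proof (rule integral_mono)
      fix \<omega>
      have "\<bar>(\<Sum>j<N. ?m j \<omega>) / real N - (\<Sum>j<N. ?q j \<omega>) / real N\<bar> = \<bar>\<Sum>j<N. ?m j \<omega> - ?q j \<omega>\<bar> / real N"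
        by (simp add: sum_subtractf flip: diff_divide_distrib)
      also have "\<dots> \<le> (\<Sum>j<N. \<bar>?m j \<omega> - ?q j \<omega>\<bar>) / real N"
        by (intro divide_right_mono sum_abs) auto
      finally show "\<bar>(\<Sum>j<N. ?m j \<omega>) / real N - ?\<mu>\<bar>
          \<le> (\<Sum>j<N. \<bar>?m j \<omega> - ?q j \<omega>\<bar>) / real N + \<bar>(\<Sum>j<N. ?q j \<omega>) / real N - ?\<mu>\<bar>" by linarith
    qed (use iq integrable_mix in auto)
    also have "\<dots> = (\<Sum>j<N. expectation (\<lambda>\<omega>. \<bar>?m j \<omega> - ?q j \<omega>\<bar>)) / real N
        + expectation (\<lambda>\<omega>. \<bar>(\<Sum>j<N. ?q j \<omega>) / real N - ?\<mu>\<bar>)"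
      using iq integrable_mix by simp
    also have "(\<Sum>j<N. expectation (\<lambda>\<omega>. \<bar>?m j \<omega> - ?q j \<omega>\<bar>)) / real N
        \<le> (\<Sum>j<N. expectation (\<lambda>\<omega>. mix_error N \<beta> (Y \<omega>))) / real N"
      by (intro divide_right_mono sum_mono mix_ln_q_Yt elim) auto
    also have "\<dots> = expectation (\<lambda>\<omega>. mix_error N \<beta> (Y \<omega>))" using elim by simp
    finally show ?case by simp
  qed
qed auto

end

section \<open>Uniform convergence and consistency\<close>

context matched_unmatched_samples
begin

definition loglik :: "nat \<Rightarrow> real^'p \<Rightarrow> 'a \<Rightarrow> real" where
  "loglik k \<beta> \<omega> = ell_nm \<alpha> d (\<lambda>i. Xt i \<omega>) (\<lambda>j. Yt j \<omega>) (\<lambda>i. Xs i \<omega>) (\<lambda>i. Ys i \<omega>) (n k) (m k) \<beta>"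

lemma loglik_eq:
  "loglik k \<beta> \<omega> = 1 / real (n k + m k) * (\<Sum>j<n k. mix (n k) \<beta> (\<lambda>i. Xt i \<omega>) (Yt j \<omega>))
    + 1 / real (n k + m k) * (\<Sum>i<m k. ln (f (Ys i \<omega> - \<beta> \<bullet> Xs i \<omega>)))"
  unfolding loglik_def ell_nm_def mix_def by simp

text \<open>An empty sample is harmless: both sides vanish when \<open>N = 0\<close>.\<close>

lemma weighted_avg_eq:
  "real N / real K * ((\<Sum>i<N. x i) / real N) = 1 / real K * (\<Sum>i<N. x i)"
  by (cases "N = 0") auto

lemma Ys_integrable: "g \<in> borel_measurable borel \<Longrightarrow> integrable M (\<lambda>\<omega>. g (Ys k \<omega>)) \<longleftrightarrow> integrable M (\<lambda>\<omega>. g (Y \<omega>))"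
  for g :: "real \<Rightarrow> real"
  by (rule matched_integrable[of "\<lambda>x y. g y"]) simp

lemma Ys_expectation: "g \<in> borel_measurable borel \<Longrightarrow> expectation (\<lambda>\<omega>. g (Ys k \<omega>)) = expectation (\<lambda>\<omega>. g (Y \<omega>))"
  for g :: "real \<Rightarrow> real"
  by (rule matched_expectation[of "\<lambda>x y. g y"]) simp

lemma integrable_ln_f_matched: "integrable M (\<lambda>\<omega>. ln (f (Ys i \<omega> - \<beta> \<bullet> Xs i \<omega>)))"
  using matched_integrable[of "\<lambda>x y. ln (f (y - \<beta> \<bullet> x))" i] integrable_ln_f by simp

lemma integrable_loglik: "integrable M (loglik k \<beta>)"
  unfolding loglik_eq[abs_def] using integrable_mix integrable_ln_f_matched by simp

lemma loglik_tendsto: "(\<lambda>k. expectation (\<lambda>\<omega>. \<bar>loglik k \<beta> \<omega> - ell lam \<beta>\<bar>)) \<longlonglongrightarrow> 0"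
proof -
  have "(\<lambda>N. expectation (\<lambda>\<omega>. \<bar>(\<Sum>i<N. ln (f (Ys i \<omega> - \<beta> \<bullet> Xs i \<omega>))) / real N
      - expectation (\<lambda>\<omega>. ln (f (Y \<omega> - \<beta> \<bullet> X \<omega>)))\<bar>)) \<longlonglongrightarrow> 0"
    by (rule matched_weak_law) (use integrable_ln_f_square in auto)
  from L1_limit_weighted[OF _ _ mix_avg_tendsto this n_lim m_lim ratio lam(1)]
  show ?thesis
    unfolding weighted_avg_eq loglik_eq ell_def using integrable_mix integrable_ln_f_matched by simp
qed

section \<open>Lipschitz control of the criterion and continuity of its limit\<close>

definition lip_const :: "real \<Rightarrow> nat \<Rightarrow> 'a \<Rightarrow> real" where
  "lip_const R k \<omega> = d powr (- \<alpha>) * \<alpha> * B * (1 / real (n k + m k) * ((\<Sum>j<n k. V R (Yt j \<omega>)) + (\<Sum>i<m k. V R (Ys i \<omega>))))"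

lemma lip_const_nonneg: "lip_const R k \<omega> \<ge> 0"
  unfolding lip_const_def using alpha B by (intro mult_nonneg_nonneg add_nonneg_nonneg sum_nonneg) auto

lemma
  assumes "R \<ge> 0"
  shows integrable_lip_const: "integrable M (lip_const R k)"
    and expectation_lip_const: "expectation (lip_const R k) \<le> d powr (- \<alpha>) * \<alpha> * B * expectation (\<lambda>\<omega>. V R (Y \<omega>))"
proof -
  note V = integrable_V[OF assms]
  have i: "integrable M (\<lambda>\<omega>. V R (Yt j \<omega>))" "integrable M (\<lambda>\<omega>. V R (Ys j \<omega>))" for j
    using V Yt_integrable[of "V R"] Ys_integrable[of "V R"] by auto
  show "integrable M (lip_const R k)" unfolding lip_const_def[abs_def] using i by simp
  have E: "expectation (\<lambda>\<omega>. V R (Yt j \<omega>)) = expectation (\<lambda>\<omega>. V R (Y \<omega>))"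
    "expectation (\<lambda>\<omega>. V R (Ys j \<omega>)) = expectation (\<lambda>\<omega>. V R (Y \<omega>))" for j
    by (auto simp: Yt_expectation[of "V R"] Ys_expectation[of "V R"])
  have "expectation (lip_const R k) = d powr (- \<alpha>) * \<alpha> * B * (1 / real (n k + m k) *
      (real (n k) * expectation (\<lambda>\<omega>. V R (Y \<omega>)) + real (m k) * expectation (\<lambda>\<omega>. V R (Y \<omega>))))"
    unfolding lip_const_def[abs_def] using i by (simp add: E)
  also have "\<dots> = d powr (- \<alpha>) * \<alpha> * B * (real (n k + m k) / real (n k + m k) * expectation (\<lambda>\<omega>. V R (Y \<omega>)))"
    unfolding of_nat_add distrib_right[symmetric] by simp
  \<comment> \<open>An inequality, because the quotient is 0 when both samples are empty.\<close>
  also have "\<dots> \<le> d powr (- \<alpha>) * \<alpha> * B * (1 * expectation (\<lambda>\<omega>. V R (Y \<omega>)))"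
    using alpha B by (intro mult_left_mono mult_right_mono Bochner_Integration.integral_nonneg) auto
  finally show "expectation (lip_const R k) \<le> d powr (- \<alpha>) * \<alpha> * B * expectation (\<lambda>\<omega>. V R (Y \<omega>))" by simp
qed

text \<open>The exceptional null set is where some sampled covariate leaves the ball of radius
  \<open>B\<close>; it is the same for all \<open>k\<close> and all parameters.\<close>

lemma loglik_lipschitz:
  "AE \<omega> in M. \<forall>k. \<forall>\<beta>\<in>cball 0 R. \<forall>\<beta>'\<in>cball 0 R. \<bar>loglik k \<beta> \<omega> - loglik k \<beta>' \<omega>\<bar> \<le> lip_const R k \<omega> * dist \<beta> \<beta>'"
  using Xt_bdd Xs_bdd
proof eventually_elim
  case (elim \<omega>)
  show ?case
  proof (intro allI ballI)
    fix k and \<beta> \<beta>' :: "real^'p" assume "\<beta> \<in> cball 0 R" "\<beta>' \<in> cball 0 R"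
    then have R: "norm \<beta> \<le> R" "norm \<beta>' \<le> R" by auto
    define D where "D y = d powr (- \<alpha>) * \<alpha> * B * V R y * dist \<beta> \<beta>'" for y
    let ?m = "\<lambda>\<beta> j. mix (n k) \<beta> (\<lambda>i. Xt i \<omega>) (Yt j \<omega>)" and ?g = "\<lambda>\<beta> i. ln (f (Ys i \<omega> - \<beta> \<bullet> Xs i \<omega>))"
    have 1: "\<bar>?m \<beta> j - ?m \<beta>' j\<bar> \<le> D (Yt j \<omega>)" if "j < n k" for j
      unfolding mix_def D_def using that R elim
      by (intro ln_avg_diff_le ln_f_lipschitz f_pos) auto
    have 2: "\<bar>?g \<beta> i - ?g \<beta>' i\<bar> \<le> D (Ys i \<omega>)" for i
      unfolding D_def using R elim by (intro ln_f_lipschitz) auto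
    have "\<bar>loglik k \<beta> \<omega> - loglik k \<beta>' \<omega>\<bar>
        = \<bar>1 / real (n k + m k) * ((\<Sum>j<n k. ?m \<beta> j - ?m \<beta>' j) + (\<Sum>i<m k. ?g \<beta> i - ?g \<beta>' i))\<bar>"
      unfolding loglik_eq by (simp add: sum_subtractf algebra_simps flip: add_divide_distrib diff_divide_distrib)
    also have "\<dots> = 1 / real (n k + m k) * \<bar>(\<Sum>j<n k. ?m \<beta> j - ?m \<beta>' j) + (\<Sum>i<m k. ?g \<beta> i - ?g \<beta>' i)\<bar>"
      by (simp add: abs_mult)
    also have "\<dots> \<le> 1 / real (n k + m k) * ((\<Sum>j<n k. \<bar>?m \<beta> j - ?m \<beta>' j\<bar>) + (\<Sum>i<m k. \<bar>?g \<beta> i - ?g \<beta>' i\<bar>))"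
      by (intro mult_left_mono order_trans[OF abs_triangle_ineq] add_mono sum_abs) auto
    also have "\<dots> \<le> 1 / real (n k + m k) * ((\<Sum>j<n k. D (Yt j \<omega>)) + (\<Sum>i<m k. D (Ys i \<omega>)))"
      using 1 2 by (intro mult_left_mono add_mono sum_mono) auto
    also have "\<dots> = lip_const R k \<omega> * dist \<beta> \<beta>'"
      unfolding lip_const_def D_def by (simp add: mult_ac distrib_left flip: sum_distrib_left sum_distrib_right)
    finally show "\<bar>loglik k \<beta> \<omega> - loglik k \<beta>' \<omega>\<bar> \<le> lip_const R k \<omega> * dist \<beta> \<beta>'" .
  qed
qed

lemma whp_loglik_uniform:
  assumes "R \<ge> 0" "e > 0"
  shows "whp M (\<lambda>k \<omega>. \<forall>\<beta>\<in>cball 0 R. \<bar>loglik k \<beta> \<omega> - ell lam \<beta>\<bar> \<le> e)"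
  using whp_uniform[OF integrable_loglik loglik_tendsto loglik_lipschitz integrable_lip_const[OF assms(1)]
      lip_const_nonneg expectation_lip_const[OF assms(1)] compact_cball assms(2)] .

text \<open>Obtained from the sample criteria through their common mean modulus, without
  differentiating under the integrals that define the limit.\<close>

lemma continuous_on_ell:
  assumes "R \<ge> 0"
  shows "continuous_on (cball 0 R) (ell lam)"
proof -
  let ?D = "d powr (- \<alpha>) * \<alpha> * B * expectation (\<lambda>\<omega>. V R (Y \<omega>))"
  have "\<bar>ell lam \<beta> - ell lam \<beta>'\<bar> \<le> ?D * dist \<beta> \<beta>'" if "\<beta> \<in> cball 0 R" "\<beta>' \<in> cball 0 R" for \<beta> \<beta>'
    using L1_limit_lipschitz[OF integrable_loglik loglik_tendsto loglik_lipschitz integrable_lip_const[OF assms]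
      lip_const_nonneg expectation_lip_const[OF assms] that] .
  then have "?D-lipschitz_on (cball 0 R) (ell lam)"
    using alpha B by (intro lipschitz_onI) (auto simp: dist_real_def intro!: mult_nonneg_nonneg Bochner_Integration.integral_nonneg)
  then show ?thesis by (rule lipschitz_on_continuous_on)
qed

text \<open>On the compact set left after removing the open ball around \<open>\<beta>0\<close>, the
  continuous limit attains its maximum, which lies strictly below the value at
  \<open>\<beta>0\<close>. The outer ball is closed because a maximizer may lie on its
  boundary.\<close>

lemma ell_separated:
  assumes "r > 0"
  obtains \<eta> where "\<eta> > 0" "\<And>\<beta>. norm \<beta> \<le> R \<Longrightarrow> r \<le> norm (\<beta> - \<beta>0) \<Longrightarrow> ell lam \<beta> \<le> ell lam \<beta>0 - \<eta>"
proof -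
  let ?K = "cball 0 R \<inter> {\<beta>. r \<le> norm (\<beta> - \<beta>0)}"
  show thesis
  proof (cases "?K = {}")
    case True
    then show thesis by (intro that[of 1]) auto
  next
    case False
    then have R: "R \<ge> 0" by (auto intro: order_trans[OF norm_ge_zero])
    have "compact ?K"
      by (intro compact_Int_closed compact_cball closed_Collect_le continuous_intros)
    moreover have "continuous_on ?K (ell lam)"
      using continuous_on_ell[OF R] by (rule continuous_on_subset) auto
    ultimately obtain \<beta>1 where \<beta>1: "\<beta>1 \<in> ?K" "\<And>\<beta>. \<beta> \<in> ?K \<Longrightarrow> ell lam \<beta> \<le> ell lam \<beta>1"
      using continuous_attains_sup[of ?K "ell lam"] False by blast
    from \<beta>1(1) assms have "\<beta>1 \<noteq> \<beta>0" by auto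
    from ell_less[OF lam(1) this] \<beta>1 show thesis
      by (intro that[of "ell lam \<beta>0 - ell lam \<beta>1"]) auto
  qed
qed

section \<open>Confinement of the maximizer\<close>

definition resp_avg :: "nat \<Rightarrow> 'a \<Rightarrow> real" where
  "resp_avg k \<omega> = 1 / real (n k + m k) * (\<Sum>j<n k. \<bar>Yt j \<omega>\<bar> powr \<alpha>) + 1 / real (n k + m k) * (\<Sum>i<m k. \<bar>Ys i \<omega>\<bar> powr \<alpha>)"

text \<open>Normalized by the total sample size, as in the criterion. Hence its limit carries the
  factor \<open>lam / (1 + lam)\<close>, whose inverse appears in \<open>Rstar\<close>.\<close>

definition cov_avg :: "nat \<Rightarrow> real^'p \<Rightarrow> 'a \<Rightarrow> real" where
  "cov_avg k u \<omega> = 1 / real (n k + m k) * (\<Sum>i<m k. \<bar>u \<bullet> Xs i \<omega>\<bar> powr \<alpha>)"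

lemma whp_resp_avg:
  assumes "e > 0"
  shows "whp M (\<lambda>k \<omega>. \<bar>resp_avg k \<omega> - expectation (\<lambda>\<omega>. \<bar>Y \<omega>\<bar> powr \<alpha>)\<bar> < e)"
proof -
  let ?C = "expectation (\<lambda>\<omega>. \<bar>Y \<omega>\<bar> powr \<alpha>)"
  have i: "integrable M (\<lambda>\<omega>. \<bar>Yt j \<omega>\<bar> powr \<alpha>)" "integrable M (\<lambda>\<omega>. \<bar>Ys j \<omega>\<bar> powr \<alpha>)" for j
    using integrable_Y_powr Yt_integrable[of "\<lambda>y. \<bar>y\<bar> powr \<alpha>"] Ys_integrable[of "\<lambda>y. \<bar>y\<bar> powr \<alpha>"] by auto
  have 1: "(\<lambda>N. expectation (\<lambda>\<omega>. \<bar>(\<Sum>j<N. \<bar>Yt j \<omega>\<bar> powr \<alpha>) / real N - ?C\<bar>)) \<longlonglongrightarrow> 0"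
    by (rule Yt_weak_law) (use integrable_Y_powr_square in auto)
  have 2: "(\<lambda>N. expectation (\<lambda>\<omega>. \<bar>(\<Sum>i<N. \<bar>Ys i \<omega>\<bar> powr \<alpha>) / real N - ?C\<bar>)) \<longlonglongrightarrow> 0"
    by (rule matched_weak_law[of "\<lambda>x y. \<bar>y\<bar> powr \<alpha>"]) (use integrable_Y_powr_square in auto)
  have C: "1 / (1 + lam) * ?C + lam / (1 + lam) * ?C = ?C"
    unfolding distrib_right[symmetric] add_divide_distrib[symmetric] using lam by simp
  have "(\<lambda>k. expectation (\<lambda>\<omega>. \<bar>resp_avg k \<omega> - ?C\<bar>)) \<longlonglongrightarrow> 0"
    using L1_limit_weighted[OF _ _ 1 2 n_lim m_lim ratio lam(1)] i
    unfolding weighted_avg_eq resp_avg_def C by simp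
  moreover have "integrable M (resp_avg k)" for k
    unfolding resp_avg_def[abs_def] using i by simp
  ultimately show ?thesis using assms by (intro whp_of_L1)
qed

text \<open>The direction of a maximizer is random, so the lower bound on the average must hold for
  all directions at once. The Lipschitz constant here is deterministic because the covariates are
  bounded.\<close>

lemma whp_cov_avg:
  assumes "e > 0"
  shows "whp M (\<lambda>k \<omega>. \<forall>u\<in>sphere 0 1. \<bar>cov_avg k u \<omega> - lam / (1 + lam) * expectation (\<lambda>\<omega>. \<bar>u \<bullet> X \<omega>\<bar> powr \<alpha>)\<bar> \<le> e)"
proof (rule whp_uniform)
  have bd: "AE \<omega> in M. norm (Xs i \<omega>) \<le> B" for i using Xs_bdd by eventually_elim blast
  note i = integrable_inner_powr[OF bd Xs_meas]
  show "integrable M (cov_avg k u)" for k u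
    unfolding cov_avg_def[abs_def] using i by simp
  fix u :: "real^'p"
  \<comment> \<open>The unmatched sample contributes nothing here; the zero sequence takes its place
    in the weighted limit.\<close>
  have z: "(\<lambda>N. expectation (\<lambda>\<omega>. \<bar>(0::real) - 0\<bar>)) \<longlonglongrightarrow> 0" by simp
  have "(\<lambda>N. expectation (\<lambda>\<omega>. \<bar>(\<Sum>i<N. \<bar>u \<bullet> Xs i \<omega>\<bar> powr \<alpha>) / real N - expectation (\<lambda>\<omega>. \<bar>u \<bullet> X \<omega>\<bar> powr \<alpha>)\<bar>)) \<longlonglongrightarrow> 0"
    by (rule matched_weak_law[of "\<lambda>x y. \<bar>u \<bullet> x\<bar> powr \<alpha>"])
      (use integrable_inner_powr_square[OF X_bdd X_measurable] in auto)
  from L1_limit_weighted[OF _ _ z this n_lim m_lim ratio lam(1)]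
  show "(\<lambda>k. expectation (\<lambda>\<omega>. \<bar>cov_avg k u \<omega> - lam / (1 + lam) * expectation (\<lambda>\<omega>. \<bar>u \<bullet> X \<omega>\<bar> powr \<alpha>)\<bar>)) \<longlonglongrightarrow> 0"
    unfolding weighted_avg_eq cov_avg_def using i by simp
next
  let ?\<kappa> = "\<alpha> * (B + 1) powr \<alpha> * B"
  have \<kappa>: "?\<kappa> \<ge> 0" using alpha B by simp
  show "AE \<omega> in M. \<forall>k. \<forall>u\<in>sphere 0 1. \<forall>v\<in>sphere 0 1. \<bar>cov_avg k u \<omega> - cov_avg k v \<omega>\<bar> \<le> ?\<kappa> * dist u v"
    using Xs_bdd
  proof eventually_elim
    case (elim \<omega>)
    show ?case
    proof (intro allI ballI)
      fix k and u v :: "real^'p" assume uv: "u \<in> sphere 0 1" "v \<in> sphere 0 1"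
      have "\<bar>cov_avg k u \<omega> - cov_avg k v \<omega>\<bar>
          = 1 / real (n k + m k) * \<bar>\<Sum>i<m k. \<bar>u \<bullet> Xs i \<omega>\<bar> powr \<alpha> - \<bar>v \<bullet> Xs i \<omega>\<bar> powr \<alpha>\<bar>"
        unfolding cov_avg_def by (simp add: sum_subtractf flip: diff_divide_distrib)
      also have "\<dots> \<le> 1 / real (n k + m k) * (\<Sum>i<m k. \<bar>\<bar>u \<bullet> Xs i \<omega>\<bar> powr \<alpha> - \<bar>v \<bullet> Xs i \<omega>\<bar> powr \<alpha>\<bar>)"
        by (intro mult_left_mono sum_abs) auto
      also have "\<dots> \<le> 1 / real (n k + m k) * (\<Sum>i<m k. ?\<kappa> * dist u v)"
        using uv elim by (intro mult_left_mono sum_mono inner_powr_lipschitz) auto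
      also have "\<dots> = real (m k) / real (n k + m k) * (?\<kappa> * dist u v)" by simp
      also have "\<dots> \<le> 1 * (?\<kappa> * dist u v)"
        using \<kappa> by (intro mult_right_mono mult_nonneg_nonneg[OF \<kappa>]) (auto simp: divide_le_eq_1)
      finally show "\<bar>cov_avg k u \<omega> - cov_avg k v \<omega>\<bar> \<le> ?\<kappa> * dist u v" by simp
    qed
  qed
  show "integrable M (\<lambda>\<omega>. ?\<kappa>)" "?\<kappa> \<ge> 0" "expectation (\<lambda>\<omega>. ?\<kappa>) \<le> ?\<kappa>"
    using \<kappa> by (simp_all add: prob_space)
qed (use assms in auto)

lemma cov_avg_scale: "cov_avg k (a *\<^sub>R u) \<omega> = \<bar>a\<bar> powr \<alpha> * cov_avg k u \<omega>"
  by (simp add: cov_avg_def abs_mult powr_mult sum_distrib_left mult_ac)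

text \<open>The sum is at most twice the larger summand. After taking the root, the factor
  \<open>2 powr \<alpha>\<close> becomes the leading 2 of \<open>Rstar\<close>.\<close>

lemma abs_add_powr_le: "\<bar>s + t\<bar> powr \<alpha> \<le> 2 powr \<alpha> * (\<bar>s\<bar> powr \<alpha> + \<bar>t\<bar> powr \<alpha>)" for s t :: real
proof -
  have "\<bar>s + t\<bar> powr \<alpha> \<le> (2 * max \<bar>s\<bar> \<bar>t\<bar>) powr \<alpha>" using alpha by (intro powr_mono2) auto
  also have "\<dots> = 2 powr \<alpha> * (max \<bar>s\<bar> \<bar>t\<bar>) powr \<alpha>" by (simp add: powr_mult)
  also have "(max \<bar>s\<bar> \<bar>t\<bar>) powr \<alpha> \<le> \<bar>s\<bar> powr \<alpha> + \<bar>t\<bar> powr \<alpha>" by (auto simp: max_def)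
  finally show ?thesis by simp
qed

text \<open>Bounding every mixture term by the maximum \<open>c\<close> of the noise density, a candidate that beats
  \<open>\<beta> = 0\<close> has a residual average no larger than the response average.\<close>

lemma cov_avg_le_of_loglik_ge:
  assumes n: "n k > 0" and ge: "loglik k 0 \<omega> \<le> loglik k \<beta> \<omega>"
  shows "cov_avg k \<beta> \<omega> \<le> 2 powr \<alpha> * (2 * resp_avg k \<omega>)"
proof -
  define s where "s = 1 / real (n k + m k)"
  have s: "s > 0" using n by (simp add: s_def)
  define \<delta> where "\<delta> = d powr (- \<alpha>)"
  have \<delta>: "\<delta> > 0" using d by (simp add: \<delta>_def)
  let ?res = "s * (\<Sum>i<m k. \<bar>Ys i \<omega> - \<beta> \<bullet> Xs i \<omega>\<bar> powr \<alpha>)"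
  let ?T = "s * (\<Sum>i<m k. \<bar>Ys i \<omega>\<bar> powr \<alpha>)" and ?U = "s * (\<Sum>j<n k. \<bar>Yt j \<omega>\<bar> powr \<alpha>)"
  \<comment> \<open>At \<open>\<beta> = 0\<close> the covariates drop out and the mixture is the
    noise density itself, so the criterion is explicit in the responses.\<close>
  have "mix (n k) 0 (\<lambda>i. Xt i \<omega>) y = ln c - \<delta> * \<bar>y\<bar> powr \<alpha>" for y
    using n by (simp add: mix_def ln_f \<delta>_def)
  then have L0: "loglik k 0 \<omega> = s * (real (n k) * ln c) + s * (real (m k) * ln c) - \<delta> * (?U + ?T)"
    unfolding loglik_eq by (simp add: ln_f s_def \<delta>_def sum_subtractf right_diff_distrib
        sum_distrib_left[symmetric] distrib_left diff_divide_distrib)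
  have "mix (n k) \<beta> (\<lambda>i. Xt i \<omega>) y \<le> ln c" for y
    unfolding mix_def
  proof (rule ln_mono)
    show "(\<Sum>i<n k. f (y - \<beta> \<bullet> Xt i \<omega>)) / real (n k) \<le> c"
      using sum_bounded_above[of "{..<n k}" "\<lambda>i. f (y - \<beta> \<bullet> Xt i \<omega>)" c] f_le n by (simp add: field_simps)
    show "0 < (\<Sum>i<n k. f (y - \<beta> \<bullet> Xt i \<omega>)) / real (n k)"
      using f_pos n by (intro divide_pos_pos sum_pos) auto
  qed
  then have "(\<Sum>j<n k. mix (n k) \<beta> (\<lambda>i. Xt i \<omega>) (Yt j \<omega>)) \<le> (\<Sum>j<n k. ln c)"
    by (intro sum_mono)
  then have "s * (\<Sum>j<n k. mix (n k) \<beta> (\<lambda>i. Xt i \<omega>) (Yt j \<omega>)) \<le> s * (real (n k) * ln c)"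
    using s by (intro mult_left_mono) auto
  moreover have "s * (\<Sum>i<m k. ln (f (Ys i \<omega> - \<beta> \<bullet> Xs i \<omega>))) = s * (real (m k) * ln c) - \<delta> * ?res"
    by (simp add: ln_f \<delta>_def sum_subtractf right_diff_distrib sum_distrib_left[symmetric])
  ultimately have "loglik k \<beta> \<omega> \<le> s * (real (n k) * ln c) + s * (real (m k) * ln c) - \<delta> * ?res"
    unfolding loglik_eq s_def[symmetric] by linarith
  with ge L0 have "\<delta> * ?res \<le> \<delta> * (?U + ?T)" by linarith
  then have res: "?res \<le> ?U + ?T" using \<delta> by simp
  have "cov_avg k \<beta> \<omega> \<le> s * (\<Sum>i<m k. 2 powr \<alpha> * (\<bar>Ys i \<omega>\<bar> powr \<alpha> + \<bar>Ys i \<omega> - \<beta> \<bullet> Xs i \<omega>\<bar> powr \<alpha>))"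
    unfolding cov_avg_def s_def[symmetric]
  proof (intro mult_left_mono sum_mono)
    fix i
    show "\<bar>\<beta> \<bullet> Xs i \<omega>\<bar> powr \<alpha> \<le> 2 powr \<alpha> * (\<bar>Ys i \<omega>\<bar> powr \<alpha> + \<bar>Ys i \<omega> - \<beta> \<bullet> Xs i \<omega>\<bar> powr \<alpha>)"
      using abs_add_powr_le[of "Ys i \<omega>" "- (Ys i \<omega> - \<beta> \<bullet> Xs i \<omega>)"] by (simp add: abs_minus_commute)
  qed (use s in simp)
  also have "\<dots> = 2 powr \<alpha> * (?T + ?res)"
    by (simp add: sum_distrib_left[symmetric] sum.distrib distrib_left mult_ac)
  also have "\<dots> \<le> 2 powr \<alpha> * (2 * resp_avg k \<omega>)"
  proof (intro mult_left_mono)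
    \<comment> \<open>The matched responses \<open>t\<close> occur twice, once on their own and once
      in the bound for the residuals \<open>r\<close>; this is the origin of the factor 2 in front
      of \<open>resp_avg\<close>.\<close>
    have *: "t + r \<le> 2 * (u + t)" if "r \<le> u + t" "0 \<le> u" for r t u :: real
      using that unfolding distrib_left by linarith
    have "?U \<ge> 0" using s by (intro mult_nonneg_nonneg sum_nonneg) auto
    from *[OF res this] show "?T + ?res \<le> 2 * resp_avg k \<omega>" unfolding resp_avg_def s_def[symmetric] .
  qed simp
  finally show ?thesis .
qed

text \<open>The maximum with \<open>norm \<beta>0\<close> keeps the true parameter inside the ball,
  where it is compared with the maximizer.\<close>

definition Rstar :: real where
  "Rstar = max (2 * 3 powr (1 / \<alpha>) * ((1 + lam) / lam * (expectation (\<lambda>\<omega>. \<bar>Y \<omega>\<bar> powr \<alpha>) /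
     (INF u\<in>{u::real^'p. norm u = 1}. expectation (\<lambda>\<omega>. \<bar>u \<bullet> X \<omega>\<bar> powr \<alpha>)))) powr (1 / \<alpha>)) (norm \<beta>0)"

text \<open>By homogeneity \<open>cov_avg k \<beta>\<close> is
  \<open>norm \<beta> powr \<alpha>\<close> times its value in the direction of
  \<open>\<beta>\<close>, so the uniform lower bound on the sphere turns the upper bound by the
  responses into a bound on the norm. Relative errors of one tenth on either side fit into the
  factor 3.\<close>

lemma whp_maximizer_bounded:
  "whp M (\<lambda>k \<omega>. \<forall>\<beta>. loglik k 0 \<omega> \<le> loglik k \<beta> \<omega> \<longrightarrow> norm \<beta> \<le> Rstar)"
proof -
  define C where "C = expectation (\<lambda>\<omega>. \<bar>Y \<omega>\<bar> powr \<alpha>)"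
  define b where "b = (INF u\<in>{u::real^'p. norm u = 1}. expectation (\<lambda>\<omega>. \<bar>u \<bullet> X \<omega>\<bar> powr \<alpha>))"
  define w where "w = lam / (1 + lam)"
  have C: "C > 0" unfolding C_def by (rule expectation_Y_powr_pos)
  have b: "b > 0" unfolding b_def by (rule Inf_expectation_inner_powr_pos)
  have w: "w > 0" using lam by (simp add: w_def)
  have b_le: "b \<le> expectation (\<lambda>\<omega>. \<bar>u \<bullet> X \<omega>\<bar> powr \<alpha>)" if "norm u = 1" for u
    unfolding b_def using that
    by (intro cINF_lower bdd_belowI2[where m=0] Bochner_Integration.integral_nonneg) auto
  have Q: "(1 + lam) / lam * (C / b) = C / (w * b)" using lam by (simp add: w_def)
  have R: "2 * 3 powr (1 / \<alpha>) * (C / (w * b)) powr (1 / \<alpha>) \<le> Rstar"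
    unfolding Rstar_def C_def[symmetric] b_def[symmetric] Q by simp
  have "whp M (\<lambda>k \<omega>. \<bar>resp_avg k \<omega> - C\<bar> < C / 10 \<and>
      (\<forall>u\<in>sphere 0 1. \<bar>cov_avg k u \<omega> - w * expectation (\<lambda>\<omega>. \<bar>u \<bullet> X \<omega>\<bar> powr \<alpha>)\<bar> \<le> w * b / 10))"
    using C b w by (intro whp_conj[OF whp_resp_avg[folded C_def] whp_cov_avg[folded w_def]]) auto
  moreover have "\<forall>\<^sub>F k in sequentially. n k > 0"
    by (rule eventually_compose_filterlim[OF eventually_gt_at_top n_lim])
  then have "\<forall>\<^sub>F k in sequentially. \<forall>\<omega>\<in>space M. \<bar>resp_avg k \<omega> - C\<bar> < C / 10 \<and>
      (\<forall>u\<in>sphere 0 1. \<bar>cov_avg k u \<omega> - w * expectation (\<lambda>\<omega>. \<bar>u \<bullet> X \<omega>\<bar> powr \<alpha>)\<bar> \<le> w * b / 10)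
      \<longrightarrow> (\<forall>\<beta>. loglik k 0 \<omega> \<le> loglik k \<beta> \<omega> \<longrightarrow> norm \<beta> \<le> Rstar)"
  proof eventually_elim
    case (elim k)
    show ?case
    proof (intro ballI impI allI, elim conjE)
      fix \<omega> \<beta>
      assume T: "\<bar>resp_avg k \<omega> - C\<bar> < C / 10"
        and S: "\<forall>u\<in>sphere 0 1. \<bar>cov_avg k u \<omega> - w * expectation (\<lambda>\<omega>. \<bar>u \<bullet> X \<omega>\<bar> powr \<alpha>)\<bar> \<le> w * b / 10"
        and ge: "loglik k 0 \<omega> \<le> loglik k \<beta> \<omega>"
      show "norm \<beta> \<le> Rstar"
      proof (cases "\<beta> = 0")
        case True
        then show ?thesis by (simp add: Rstar_def le_max_iff_disj)
      next
        case False
        define u where "u = \<beta> /\<^sub>R norm \<beta>"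
        have u: "norm u = 1" "\<beta> = norm \<beta> *\<^sub>R u" using False by (auto simp: u_def)
        have "w * b \<le> w * expectation (\<lambda>\<omega>. \<bar>u \<bullet> X \<omega>\<bar> powr \<alpha>)" using b_le[OF u(1)] w by simp
        moreover have "\<bar>cov_avg k u \<omega> - w * expectation (\<lambda>\<omega>. \<bar>u \<bullet> X \<omega>\<bar> powr \<alpha>)\<bar> \<le> w * b / 10"
          using S u(1) by auto
        ultimately have "9 / 10 * (w * b) \<le> cov_avg k u \<omega>" by linarith
        then have "norm \<beta> powr \<alpha> * (9 / 10 * (w * b)) \<le> norm \<beta> powr \<alpha> * cov_avg k u \<omega>"
          by (intro mult_left_mono) auto
        also have "\<dots> = cov_avg k \<beta> \<omega>" by (subst (2) u(2), subst cov_avg_scale) simp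
        also have "\<dots> \<le> 2 powr \<alpha> * (2 * resp_avg k \<omega>)" by (rule cov_avg_le_of_loglik_ge[OF elim ge])
        also have "resp_avg k \<omega> \<le> 11 / 10 * C" using T by linarith
        then have "2 powr \<alpha> * (2 * resp_avg k \<omega>) \<le> 2 powr \<alpha> * (2 * (11 / 10 * C))"
          by (intro mult_left_mono) auto
        \<comment> \<open>Here \<open>27 / 10 = 3 * (9 / 10)\<close>, so the factor
          \<open>9 / 10\<close> on the left cancels; the slack used is
          \<open>22 / 10 \<le> 27 / 10\<close>.\<close>
        also have "\<dots> \<le> 2 powr \<alpha> * (27 / 10 * C)" using C by (intro mult_left_mono) auto
        finally have "norm \<beta> powr \<alpha> * (w * b) \<le> 2 powr \<alpha> * (3 * C)" by (simp add: mult_ac)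
        then have "norm \<beta> powr \<alpha> \<le> 2 powr \<alpha> * (3 * (C / (w * b)))"
          using w b by (simp add: field_simps)
        then have "(norm \<beta> powr \<alpha>) powr (1 / \<alpha>) \<le> (2 powr \<alpha> * (3 * (C / (w * b)))) powr (1 / \<alpha>)"
          using alpha by (intro powr_mono2) auto
        also have "\<dots> = 2 * 3 powr (1 / \<alpha>) * (C / (w * b)) powr (1 / \<alpha>)"
          using alpha C w b unfolding powr_mult by (simp add: powr_powr)
        finally show ?thesis using R alpha by (simp add: powr_powr)
      qed
    qed
  qed
  ultimately show ?thesis by (rule whp_mono)
qed

section \<open>Uniform convergence, identifiability and consistency\<close>

lemma Rstar_nonneg: "Rstar \<ge> 0" and norm_\<beta>0_le_Rstar: "norm \<beta>0 \<le> Rstar"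
  by (auto simp: Rstar_def le_max_iff_disj)

lemma uniform_convergence:
  "conv_prob_zero M (\<lambda>k \<omega>. SUP \<beta>\<in>{\<beta>. norm \<beta> \<le> Rstar}. ereal \<bar>loglik k \<beta> \<omega> - ell lam \<beta>\<bar>)"
  unfolding conv_prob_zero_iff_whp
proof (intro allI impI)
  fix e :: real assume "e > 0"
  from whp_loglik_uniform[OF Rstar_nonneg this]
  show "whp M (\<lambda>k \<omega>. (SUP \<beta>\<in>{\<beta>. norm \<beta> \<le> Rstar}. ereal \<bar>loglik k \<beta> \<omega> - ell lam \<beta>\<bar>) \<le> ereal e)"
    by (rule whp_mono) (auto intro!: always_eventually SUP_least)
qed

text \<open>The gap \<open>\<eta>\<close> from compactness survives the supremum. In
  \<open>ereal\<close> the region may be empty, with supremum \<open>-\<infinity>\<close>.\<close>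

lemma identifiability:
  assumes "r > 0"
  shows "(SUP \<beta>\<in>{\<beta>. norm \<beta> < Rstar} \<inter> {\<beta>. norm (\<beta> - \<beta>0) > r}. ereal (ell lam \<beta>)) < ereal (ell lam \<beta>0)"
proof -
  obtain \<eta> where \<eta>: "\<eta> > 0" "\<And>\<beta>. norm \<beta> \<le> Rstar \<Longrightarrow> r \<le> norm (\<beta> - \<beta>0) \<Longrightarrow> ell lam \<beta> \<le> ell lam \<beta>0 - \<eta>"
    using ell_separated[OF assms, of Rstar] by blast
  have "(SUP \<beta>\<in>{\<beta>. norm \<beta> < Rstar} \<inter> {\<beta>. norm (\<beta> - \<beta>0) > r}. ereal (ell lam \<beta>)) \<le> ereal (ell lam \<beta>0 - \<eta>)"
    using \<eta>(2) by (intro SUP_least) auto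
  also have "\<dots> < ereal (ell lam \<beta>0)" using \<eta>(1) by simp
  finally show ?thesis .
qed

text \<open>With uniform error \<open>\<eta> / 3\<close>, the maximizer satisfies
  \<open>ell lam (\<beta>hat) \<ge> ell lam \<beta>0 - 2 * \<eta> / 3\<close>, which is above the
  level \<open>ell lam \<beta>0 - \<eta>\<close> that bounds the limit at distance \<open>e\<close>
  or more. The estimator may be any selection of maximizers, measurable or not.\<close>

lemma consistency:
  assumes max: "\<And>k \<omega> \<beta>. \<omega> \<in> space M \<Longrightarrow> loglik k \<beta> \<omega> \<le> loglik k (\<beta>hat k \<omega>) \<omega>"
  shows "conv_prob_zero M (\<lambda>k \<omega>. ereal (norm (\<beta>hat k \<omega> - \<beta>0)))"
  unfolding conv_prob_zero_iff_whp
proof (intro allI impI)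
  fix e :: real assume e: "e > 0"
  obtain \<eta> where \<eta>: "\<eta> > 0" "\<And>\<beta>. norm \<beta> \<le> Rstar \<Longrightarrow> e \<le> norm (\<beta> - \<beta>0) \<Longrightarrow> ell lam \<beta> \<le> ell lam \<beta>0 - \<eta>"
    using ell_separated[OF e, of Rstar] by blast
  have "whp M (\<lambda>k \<omega>. (\<forall>\<beta>\<in>cball 0 Rstar. \<bar>loglik k \<beta> \<omega> - ell lam \<beta>\<bar> \<le> \<eta> / 3) \<and>
      (\<forall>\<beta>. loglik k 0 \<omega> \<le> loglik k \<beta> \<omega> \<longrightarrow> norm \<beta> \<le> Rstar))"
    using \<eta> by (intro whp_conj whp_maximizer_bounded whp_loglik_uniform Rstar_nonneg) auto
  then show "whp M (\<lambda>k \<omega>. ereal (norm (\<beta>hat k \<omega> - \<beta>0)) \<le> ereal e)"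
  proof (rule whp_mono, intro always_eventually allI ballI impI)
    fix k \<omega> assume \<omega>: "\<omega> \<in> space M"
      and *: "(\<forall>\<beta>\<in>cball 0 Rstar. \<bar>loglik k \<beta> \<omega> - ell lam \<beta>\<bar> \<le> \<eta> / 3) \<and>
      (\<forall>\<beta>. loglik k 0 \<omega> \<le> loglik k \<beta> \<omega> \<longrightarrow> norm \<beta> \<le> Rstar)"
    let ?\<beta> = "\<beta>hat k \<omega>"
    \<comment> \<open>Maximality against the competitor \<open>0\<close> is what confinement asks
      for; maximality against \<open>\<beta>0\<close> is used only afterwards.\<close>
    have bd: "norm ?\<beta> \<le> Rstar" using * max[OF \<omega>] by blast
    then have 1: "\<bar>loglik k ?\<beta> \<omega> - ell lam ?\<beta>\<bar> \<le> \<eta> / 3" using * by auto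
    have 2: "\<bar>loglik k \<beta>0 \<omega> - ell lam \<beta>0\<bar> \<le> \<eta> / 3" using * norm_\<beta>0_le_Rstar by auto
    have 3: "loglik k \<beta>0 \<omega> \<le> loglik k ?\<beta> \<omega>" by (rule max[OF \<omega>])
    have "\<not> e \<le> norm (?\<beta> - \<beta>0)"
    proof
      assume "e \<le> norm (?\<beta> - \<beta>0)"
      from \<eta>(2)[OF bd this] \<eta>(1) 1 2 3 show False by linarith
    qed
    then show "ereal (norm (?\<beta> - \<beta>0)) \<le> ereal e" by simp
  qed
qed

end

theorem theorem1:
  fixes M :: "'a measure"
    and X :: "'a \<Rightarrow> real^'p" and eps Y :: "'a \<Rightarrow> real"
    and fX :: "real^'p \<Rightarrow> real" and \<beta>0 :: "real^'p"
    and \<alpha> d B lam :: real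
    and Xt Xs :: "nat \<Rightarrow> 'a \<Rightarrow> real^'p" and Yt Ys :: "nat \<Rightarrow> 'a \<Rightarrow> real"
    and n m :: "nat \<Rightarrow> nat"
  assumes M: "prob_space M"
    and fX_nonneg: "\<And>x. fX x \<ge> 0"
    and X_dens: "distributed M lborel X (\<lambda>x. ennreal (fX x))"
    and B: "B > 0" and X_bdd: "AE \<omega> in M. norm (X \<omega>) \<le> B"
    and X_hyper: "\<And>v. v \<noteq> 0 \<Longrightarrow> measure M {\<omega> \<in> space M. v \<bullet> X \<omega> = 0} = 0"
    and alpha: "\<alpha> \<ge> 1" and d: "d > 0"
    and eps_dens: "distributed M lborel eps (\<lambda>t. ennreal (noise_dens \<alpha> d t))"
    and indep: "prob_space.indep_var M borel (\<lambda>\<omega>. (X \<omega>, 0::real)) borel (\<lambda>\<omega>. (0::real^'p, eps \<omega>))"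
    and Y_def: "\<And>\<omega>. Y \<omega> = \<beta>0 \<bullet> X \<omega> + eps \<omega>"
    and Xt_meas: "\<And>i. Xt i \<in> borel_measurable M"
    and Yt_meas: "\<And>j. Yt j \<in> borel_measurable M"
    and Xs_meas: "\<And>k. Xs k \<in> borel_measurable M"
    and Ys_meas: "\<And>k. Ys k \<in> borel_measurable M"
    and Xt_law: "\<And>i. distr M borel (Xt i) = distr M borel X"
    and Yt_law: "\<And>j. distr M borel (Yt j) = distr M borel Y"
    and XYs_law: "\<And>k. distr M borel (\<lambda>\<omega>. (Xs k \<omega>, Ys k \<omega>)) = distr M borel (\<lambda>\<omega>. (X \<omega>, Y \<omega>))"
    and samples_indep: "prob_space.indep_vars M (\<lambda>_. borel)
        (\<lambda>s \<omega>. case s of Inl i \<Rightarrow> (Xt i \<omega>, 0::real)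
                      | Inr (Inl j) \<Rightarrow> (0, Yt j \<omega>)
                      | Inr (Inr k) \<Rightarrow> (Xs k \<omega>, Ys k \<omega>)) UNIV"
    and n_lim: "filterlim n at_top sequentially"
    and m_lim: "filterlim m at_top sequentially"
    and ratio: "(\<lambda>k. real (m k) / real (n k)) \<longlonglongrightarrow> lam"
    and lam: "0 < lam" "lam < 1"
  defines "Rstar \<equiv> max (2 * 3 powr (1 / \<alpha>) * ((1 + lam) / lam * ((prob_space.expectation M (\<lambda>\<omega>. \<bar>Y \<omega>\<bar> powr \<alpha>)) / (INF u\<in>{u::real^'p. norm u = 1}. prob_space.expectation M (\<lambda>\<omega>. \<bar>u \<bullet> X \<omega>\<bar> powr \<alpha>)))) powr (1 / \<alpha>)) (norm \<beta>0)"
    and "L \<equiv> (\<lambda>k \<beta> \<omega>. ell_nm \<alpha> d (\<lambda>i. Xt i \<omega>) (\<lambda>j. Yt j \<omega>) (\<lambda>i. Xs i \<omega>) (\<lambda>i. Ys i \<omega>)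
                                  (n k) (m k) \<beta>)"
    and "ell \<equiv> ell_pop \<alpha> d lam \<beta>0 fX"
  shows "conv_prob_zero M (\<lambda>k \<omega>. SUP \<beta>\<in>{\<beta>. norm \<beta> \<le> Rstar}. ereal \<bar>L k \<beta> \<omega> - ell \<beta>\<bar>)
     \<and> (\<forall>r>0. (SUP \<beta>\<in>{\<beta>. norm \<beta> < Rstar} \<inter> {\<beta>. norm (\<beta> - \<beta>0) > r}. ereal (ell \<beta>)) < ereal (ell \<beta>0))
     \<and> (\<forall>\<beta>hat :: nat \<Rightarrow> 'a \<Rightarrow> real^'p.
          (\<forall>k. \<forall>\<omega>\<in>space M. \<forall>\<beta>. L k \<beta> \<omega> \<le> L k (\<beta>hat k \<omega>) \<omega>) \<longrightarrow>
          conv_prob_zero M (\<lambda>k \<omega>. ereal (norm (\<beta>hat k \<omega> - \<beta>0))))"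
proof -
  interpret S: matched_unmatched_samples M X eps Y fX \<beta>0 \<alpha> d B Xt Xs Yt Ys n m lam
    by (intro matched_unmatched_samples.intro regression_model.intro regression_model_axioms.intro
        matched_unmatched_samples_axioms.intro)
      (fact M fX_nonneg X_dens B X_bdd X_hyper alpha d eps_dens indep Y_def
        Xt_meas Yt_meas Xs_meas Ys_meas Xt_law Yt_law XYs_law samples_indep n_lim m_lim ratio lam)+
  have R: "Rstar = S.Rstar" unfolding Rstar_def S.Rstar_def ..
  have L: "L = S.loglik" by (simp add: L_def S.loglik_def fun_eq_iff)
  have E: "ell = S.ell lam" by (simp add: ell_def S.ell_pop_eq fun_eq_iff)
  show ?thesis
    unfolding R L E using S.uniform_convergence S.identifiability S.consistency by blast
qed

end
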